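(* Let $n\ge1$. For every multi-partition $\pmb\lambda=(\lambda^{(1)},\dots,\lambda^{(n)})$, in plethystic notation, $$P_{\pmb\lambda}^{(q^{-1},t^{-1})}[X^{(1)},X^{(2)},\ldots,X^{(n)}]=q^{n(\overline{\pmb\lambda})-(n-1)|\overline{\pmb\lambda}|}\,P_{\pmb\lambda}^{(q,t)}[q^{n-1}X^{(1)},q^{n-2}X^{(2)},\ldots,X^{(n)}].$$
   Context: For $i=1,\dots,n$ let $x^{(i)}=(x^{(i)}_1,x^{(i)}_2,\dots)$ be an infinite alphabet and $X^{(i)}=x^{(i)}_1+x^{(i)}_2+\cdots$. A multi-partition is an $n$-tuple of partitions. Set $m_{\pmb\lambda}=m_{\lambda^{(1)}}(x^{(1)})\cdots m_{\lambda^{(n)}}(x^{(n)})$ and $p_{\pmb\lambda}=p_{\lambda^{(1)}}(x^{(1)})\,p_{\lambda^{(2)}}(x^{(1)},x^{(2)})\cdots p_{\lambda^{(n)}}(x^{(1)},\dots,x^{(n)})$, with $m_\lambda,p_\lambda$ the usual monomial and power-sum symmetric functions; the space of multi-symmetric functions is the $\mathbb Q(q,t)$-vector space with basis $\{m_{\pmb\lambda}\}$. Dominance ordering on multi-partitions: $\pmb\mu\le\pmb\lambda$ iff $\big(\sum_{i<k}|\mu^{(i)}|\big)+\mu^{(k)}_1+\cdots+\mu^{(k)}_j\le\big(\sum_{i<k}|\lambda^{(i)}|\big)+\lambda^{(k)}_1+\cdots+\lambda^{(k)}_j$ for all $j,k$. Let $\overline{\pmb\lambda}=(|\lambda^{(1)}|,\dots,|\lambda^{(n)}|)$,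 $|\alpha|=\sum_i\alpha_i$ and $n(\alpha)=\sum_i(i-1)\alpha_i$ for $\alpha\in\mathbb N^n$, and $z_\lambda=\prod_{i\ge1}i^{m_i(\lambda)}m_i(\lambda)!$ with $m_i(\lambda)$ the number of parts of $\lambda$ equal to $i$. The bilinear scalar product is $\langle\!\langle p_{\pmb\lambda},p_{\pmb\mu}\rangle\!\rangle_{q,t,n}=\delta_{\pmb\lambda,\pmb\mu}\,q^{(n-1)|\overline{\pmb\lambda}|-n(\overline{\pmb\lambda})}z_{\lambda^{(1)}}\cdots z_{\lambda^{(n)}}\prod_{i=1}^{\ell(\lambda^{(n)})}\frac{1-q^{\lambda^{(n)}_i}}{1-t^{\lambda^{(n)}_i}}$. The multi-Macdonald polynomials $\{P^{(q,t)}_{\pmb\lambda}(x^{(1)},\dots,x^{(n)})\}$ are the unique basis of the space of multi-symmetric functions with $P^{(q,t)}_{\pmb\lambda}=m_{\pmb\lambda}+$ (a linear combination of $m_{\pmb\mu}$, $\pmb\mu<\pmb\lambda$) and $\langle\!\langle P^{(q,t)}_{\pmb\lambda},P^{(q,t)}_{\pmb\mu}\rangle\!\rangle_{q,t,n}=0$ for $\pmb\lambda\ne\pmb\mu$. $P^{(q^{-1},t^{-1})}_{\pmb\lambda}$ is obtained from $P^{(q,t)}_{\pmb\lambda}$ by replacing $q,t$ by $q^{-1},t^{-1}$ in its coefficients. Writing a multi-symmetric function $f$ as $f[X^{(1)},\dots,X^{(n)}]$, the expression $f[q^{n-1}X^{(1)},q^{n-2}X^{(2)},\dots,X^{(n)}]$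 is the image of $f$ under the $\mathbb Q(q,t)$-algebra homomorphism $p_r(x^{(i)})\mapsto q^{(n-i)r}p_r(x^{(i)})$ (i.e. $x^{(i)}_j\mapsto q^{n-i}x^{(i)}_j$), the coefficients of $f$ being left unchanged. *)

theory Defs
  imports
    "HOL-Computational_Algebra.Polynomial_Factorial"
    "HOL-Library.Poly_Mapping"
    "HOL-Library.Multiset"
begin

section \<open>Formal power series in an arbitrary set of variables\<close>

text \<open>
  A monomial in the variables \<open>'v\<close> is a finitely supported exponent vector, and a series is
  an arbitrary family of coefficients, so that infinite sums such as a power sum of an infinite
  alphabet are available.
\<close>

typedef ('v, 'a) mfps = "UNIV :: (('v \<Rightarrow>\<^sub>0 nat) \<Rightarrow> 'a) set"
  morphisms mfps_nth Abs_mfps ..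

setup_lifting type_definition_mfps

lemma mfps_eqI: "(\<And>m. mfps_nth f m = mfps_nth g m) \<Longrightarrow> f = g"
  by (simp add: mfps_nth_inject[symmetric] fun_eq_iff)

lemma finite_monomial_divisors: "finite {a :: 'v \<Rightarrow>\<^sub>0 nat. \<exists>b. a + b = m}"
proof -
  let ?N = "\<Sum>v\<in>Poly_Mapping.keys m. Poly_Mapping.lookup m v"
  have sub: "Poly_Mapping.lookup ` {a. \<exists>b. a + b = m} \<subseteq>
      {f. \<forall>v. (v \<in> Poly_Mapping.keys m \<longrightarrow> f v \<in> {..?N}) \<and> (v \<notin> Poly_Mapping.keys m \<longrightarrow> f v = 0)}"
  proof (clarify, intro conjI impI)
    fix a b :: "'v \<Rightarrow>\<^sub>0 nat" and v assume "v \<in> Poly_Mapping.keys (a + b)"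
    hence "Poly_Mapping.lookup (a + b) v \<le>
        (\<Sum>v\<in>Poly_Mapping.keys (a + b). Poly_Mapping.lookup (a + b) v)"
      by (intro member_le_sum) auto
    thus "Poly_Mapping.lookup a v \<in> {..(\<Sum>v\<in>Poly_Mapping.keys (a + b). Poly_Mapping.lookup (a + b) v)}"
      by (simp add: lookup_add)
  next
    fix a b :: "'v \<Rightarrow>\<^sub>0 nat" and v assume "v \<notin> Poly_Mapping.keys (a + b)"
    thus "Poly_Mapping.lookup a v = 0" by (simp add: in_keys_iff lookup_add)
  qed
  have "finite (Poly_Mapping.lookup ` {a. \<exists>b. a + b = m})"
    by (rule finite_subset[OF sub]) (rule finite_set_of_finite_funs, auto)
  thus ?thesis
    by (rule finite_imageD) (simp add: inj_on_def lookup_inject)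
qed

lemma finite_monomial_splits: "finite {(a, b). a + b = (m :: 'v \<Rightarrow>\<^sub>0 nat)}"
proof (rule finite_subset)
  show "{(a, b). a + b = m} \<subseteq> {a. \<exists>b. a + b = m} \<times> {a. \<exists>b. a + b = m}"
    by (auto intro: add.commute)
  show "finite ({a. \<exists>b. a + b = m} \<times> {a. \<exists>b. a + b = m})"
    using finite_monomial_divisors by blast
qed

instantiation mfps :: (type, comm_ring_1) comm_ring_1
begin

lift_definition zero_mfps :: "('a, 'b) mfps" is "\<lambda>_. 0" .
lift_definition one_mfps :: "('a, 'b) mfps" is "\<lambda>m. if m = 0 then 1 else 0" .
lift_definition plus_mfps :: "('a, 'b) mfps \<Rightarrow> ('a, 'b) mfps \<Rightarrow> ('a, 'b) mfps" is
  "\<lambda>f g m. f m + g m" .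
lift_definition minus_mfps :: "('a, 'b) mfps \<Rightarrow> ('a, 'b) mfps \<Rightarrow> ('a, 'b) mfps" is
  "\<lambda>f g m. f m - g m" .
lift_definition uminus_mfps :: "('a, 'b) mfps \<Rightarrow> ('a, 'b) mfps" is
  "\<lambda>f m. - f m" .
lift_definition times_mfps :: "('a, 'b) mfps \<Rightarrow> ('a, 'b) mfps \<Rightarrow> ('a, 'b) mfps" is
  "\<lambda>f g m. \<Sum>(a, b) | a + b = m. f a * g b" .

instance
proof
  fix f g h :: "('a, 'b) mfps"
  show "f * g * h = f * (g * h)"
  proof (transfer, rule ext)
    fix f g h :: "('a \<Rightarrow>\<^sub>0 nat) \<Rightarrow> 'b" and m
    have "(\<Sum>(c, d) | c + d = m. (\<Sum>(a, b) | a + b = c. f a * g b) * h d)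
        = (\<Sum>(x, y)\<in>(SIGMA x:{(c, d). c + d = m}. {(a, b). a + b = fst x}).
             f (fst y) * g (snd y) * h (snd x))"
      by (subst sum.Sigma[symmetric])
         (auto simp: finite_monomial_splits[unfolded case_prod_unfold] sum_distrib_right case_prod_unfold intro!: sum.cong)
    also have "\<dots> = (\<Sum>(x, y)\<in>(SIGMA x:{(a, e). a + e = m}. {(b, d). b + d = snd x}).
             f (fst x) * (g (fst y) * h (snd y)))"
      by (rule sum.reindex_bij_witness[where
            i = "\<lambda>((a, e), (b, d)). ((a + b, d), (a, b))" and
            j = "\<lambda>((c, d), (a, b)). ((a, b + d), (b, d))"])
         (auto simp: ac_simps)
    also have "\<dots> = (\<Sum>(a, e) | a + e = m. f a * (\<Sum>(b, d) | b + d = e. g b * h d))"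
      by (subst sum.Sigma[symmetric])
         (auto simp: finite_monomial_splits[unfolded case_prod_unfold] sum_distrib_left case_prod_unfold intro!: sum.cong)
    finally show "(\<Sum>(c, d) | c + d = m. (\<Sum>(a, b) | a + b = c. f a * g b) * h d)
        = (\<Sum>(a, e) | a + e = m. f a * (\<Sum>(b, d) | b + d = e. g b * h d))" .
  qed
  show "f * g = g * f"
  proof (transfer, rule ext)
    fix f g :: "('a \<Rightarrow>\<^sub>0 nat) \<Rightarrow> 'b" and m
    show "(\<Sum>(a, b) | a + b = m. f a * g b) = (\<Sum>(a, b) | a + b = m. g a * f b)"
      by (rule sum.reindex_bij_witness[where i = prod.swap and j = prod.swap])
         (auto simp: ac_simps)
  qed
  show "1 * f = f"
  proof (transfer, rule ext)
    fix f :: "('a \<Rightarrow>\<^sub>0 nat) \<Rightarrow> 'b" and m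
    have "(\<Sum>(a, b) | a + b = m. (if a = 0 then 1 else 0) * f b)
        = (\<Sum>(a, b)\<in>{(0 :: 'a \<Rightarrow>\<^sub>0 nat, m)}. (if a = 0 then 1 else 0) * f b)"
      by (rule sum.mono_neutral_right) (auto simp: finite_monomial_splits split: if_splits)
    thus "(\<Sum>(a, b) | a + b = m. (if a = 0 then 1 else 0) * f b) = f m"
      by simp
  qed
  show "(f + g) * h = f * h + g * h"
    by transfer (simp add: fun_eq_iff case_prod_unfold distrib_right sum.distrib)
  show "(0 :: ('a, 'b) mfps) \<noteq> 1"
    by transfer (auto simp: fun_eq_iff)
qed (transfer; simp add: fun_eq_iff)+

end

lift_definition mfps_scale :: "'a::comm_ring_1 \<Rightarrow> ('v, 'a) mfps \<Rightarrow> ('v, 'a) mfps" is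
  "\<lambda>c f m. c * f m" .

interpretation mfps: vector_space "mfps_scale :: 'a::field \<Rightarrow> ('v, 'a) mfps \<Rightarrow> ('v, 'a) mfps"
  by unfold_locales (transfer; simp add: fun_eq_iff algebra_simps)+

lift_definition map_mfps :: "('a \<Rightarrow> 'b) \<Rightarrow> ('v, 'a) mfps \<Rightarrow> ('v, 'b) mfps" is
  "\<lambda>h f m. h (f m)" .

text \<open>
  \<open>rescale_vars c\<close> is the substitution of \<open>c v * v\<close> for every variable \<open>v\<close>.
\<close>

lift_definition rescale_vars :: "('v \<Rightarrow> 'a::comm_ring_1) \<Rightarrow> ('v, 'a) mfps \<Rightarrow> ('v, 'a) mfps" is
  "\<lambda>c f m. f m * (\<Prod>v\<in>Poly_Mapping.keys m. c v ^ Poly_Mapping.lookup m v)" .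

lemma rescale_vars_add: "rescale_vars c (f + g) = rescale_vars c f + rescale_vars c g"
  by transfer (simp add: fun_eq_iff distrib_right)

lemma rescale_vars_scale: "rescale_vars c (mfps_scale a f) = mfps_scale a (rescale_vars c f)"
  by transfer (simp add: fun_eq_iff mult.assoc)

lemma rescale_vars_one: "rescale_vars c 1 = 1"
  by transfer (auto simp: fun_eq_iff)

lemma rescale_vars_mult:
  fixes c :: "'v \<Rightarrow> 'a::comm_ring_1"
  shows "rescale_vars c (f * g) = rescale_vars c f * rescale_vars c g"
proof (transfer, rule ext)
  fix c :: "'v \<Rightarrow> 'a" and f g :: "('v \<Rightarrow>\<^sub>0 nat) \<Rightarrow> 'a" and m
  define e where "e = (\<lambda>m :: 'v \<Rightarrow>\<^sub>0 nat. \<Prod>v\<in>Poly_Mapping.keys m. c v ^ Poly_Mapping.lookup m v)"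
  have e: "e m = (\<Prod>v\<in>S. c v ^ Poly_Mapping.lookup m v)" if "Poly_Mapping.keys m \<subseteq> S" "finite S" for m S
    unfolding e_def using that
    by (intro prod.mono_neutral_left) (auto simp: in_keys_iff)
  have "e (a + b) = e a * e b" for a b
    by (subst (1 2 3) e[where S = "Poly_Mapping.keys a \<union> Poly_Mapping.keys b"])
       (auto simp: lookup_add power_add prod.distrib keys_add)
  hence "(\<Sum>(a, b) | a + b = m. f a * g b) * e m
      = (\<Sum>(a, b) | a + b = m. f a * e a * (g b * e b))"
    by (auto simp: sum_distrib_right intro!: sum.cong)
  thus "(\<Sum>(a, b) | a + b = m. f a * g b) * (\<Prod>v\<in>Poly_Mapping.keys m. c v ^ Poly_Mapping.lookup m v)
      = (\<Sum>(a, b) | a + b = m. f a * (\<Prod>v\<in>Poly_Mapping.keys a. c v ^ Poly_Mapping.lookup a v)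
          * (g b * (\<Prod>v\<in>Poly_Mapping.keys b. c v ^ Poly_Mapping.lookup b v)))"
    by (simp add: e_def)
qed


section \<open>Symmetric functions of an alphabet\<close>

definition is_partition :: "nat list \<Rightarrow> bool" where
  "is_partition l \<longleftrightarrow> sorted_wrt (\<ge>) l \<and> 0 \<notin> set l"

definition zee :: "nat list \<Rightarrow> nat" where
  "zee l = (\<Prod>i\<in>set l. i ^ count_list l i * fact (count_list l i))"

text \<open>
  The alphabet \<open>A\<close> is a set of variables. The monomial symmetric function is the sum of all
  distinct monomials in \<open>A\<close> whose multiset of nonzero exponents is the given partition.
\<close>

definition monomial_sym :: "'v set \<Rightarrow> nat list \<Rightarrow> ('v, 'a::comm_ring_1) mfps" where
  "monomial_sym A l = Abs_mfps (\<lambda>m.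
     if Poly_Mapping.keys m \<subseteq> A \<and>
        image_mset (Poly_Mapping.lookup m) (mset_set (Poly_Mapping.keys m)) = mset l then 1 else 0)"

definition power_sum :: "'v set \<Rightarrow> nat \<Rightarrow> ('v, 'a::comm_ring_1) mfps" where
  "power_sum A r = Abs_mfps (\<lambda>m. if \<exists>v\<in>A. m = Poly_Mapping.single v r then 1 else 0)"

definition power_sum_sym :: "'v set \<Rightarrow> nat list \<Rightarrow> ('v, 'a::comm_ring_1) mfps" where
  "power_sum_sym A l = (\<Prod>r\<leftarrow>l. power_sum A r)"

lemma rescale_vars_power_sum:
  assumes "r > 0" and "\<And>v. v \<in> A \<Longrightarrow> c v = a"
  shows "rescale_vars c (power_sum A r) = mfps_scale (a ^ r) (power_sum A r)"
  using assms
  by (intro mfps_eqI)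
     (auto simp: rescale_vars.rep_eq mfps_scale.rep_eq power_sum_def Abs_mfps_inverse)


section \<open>The field of rational functions in q and t\<close>

text \<open>
  The field is the fraction field of \<open>\<rat>[q][t]\<close>; the outer polynomial variable is t.
\<close>

type_synonym qt = "rat poly poly fract"

definition qq :: qt where "qq = to_fract [:[:0, 1:]:]"
definition tt :: qt where "tt = to_fract [:0, 1:]"

definition qt_poly_eval :: "rat poly poly \<Rightarrow> qt \<Rightarrow> qt \<Rightarrow> qt" where
  "qt_poly_eval u a b =
     poly (map_poly (\<lambda>c. poly (map_poly (\<lambda>r. to_fract [:[:r:]:]) c) a) u) b"

lemma poly_map_poly_add:
  fixes h :: "'a::comm_ring_1 \<Rightarrow> 'b::comm_ring_1"
  assumes "h 0 = 0" "\<And>x y. h (x + y) = h x + h y"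
  shows "poly (map_poly h (p + r)) b = poly (map_poly h p) b + poly (map_poly h r) b"
proof -
  have "map_poly h (p + r) = map_poly h p + map_poly h r"
    by (rule poly_eqI) (simp add: coeff_map_poly assms)
  thus ?thesis by simp
qed

lemma poly_map_poly_mult:
  fixes h :: "'a::comm_ring_1 \<Rightarrow> 'b::comm_ring_1"
  assumes "h 0 = 0" "\<And>x y. h (x + y) = h x + h y" "\<And>x y. h (x * y) = h x * h y"
  shows "poly (map_poly h (p * r)) b = poly (map_poly h p) b * poly (map_poly h r) b"
proof (induction p)
  case (pCons a p)
  have 1: "map_poly h (smult a r) = smult (h a) (map_poly h r)"
    by (rule poly_eqI) (simp add: coeff_map_poly assms)
  have 2: "map_poly h (pCons c s) = pCons (h c) (map_poly h s)" for c s
    by (rule poly_eqI) (simp add: coeff_map_poly coeff_pCons assms split: nat.split)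
  show ?case
    by (simp add: poly_map_poly_add assms 1 2 pCons.IH algebra_simps)
qed simp

lemma qt_poly_eval_mult: "qt_poly_eval (u * v) a b = qt_poly_eval u a b * qt_poly_eval v a b"
  unfolding qt_poly_eval_def
  by (intro poly_map_poly_mult poly_map_poly_add)
     (simp_all flip: to_fract_add to_fract_mult)

lemma qt_poly_eval_add: "qt_poly_eval (u + v) a b = qt_poly_eval u a b + qt_poly_eval v a b"
  unfolding qt_poly_eval_def
  by (intro poly_map_poly_add poly_map_poly_mult)
     (simp_all flip: to_fract_add to_fract_mult)

lemma poly_map_poly_inverse:
  fixes h :: "'a::comm_ring_1 \<Rightarrow> 'b::field"
  assumes "\<And>x. h x = 0 \<longleftrightarrow> x = 0" "b \<noteq> 0"
  shows "b ^ degree p * poly (map_poly h p) (inverse b) = poly (map_poly h (reflect_poly p)) b"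
proof -
  have "degree (map_poly h p) = degree p"
    by (intro degree_map_poly) (use assms in auto)
  moreover have "map_poly h (reflect_poly p) = reflect_poly (map_poly h p)"
    by (rule poly_eqI) (simp add: coeff_map_poly coeff_reflect_poly assms calculation)
  ultimately show ?thesis using assms(2) by (simp add: poly_reflect_poly_nz)
qed

lemma qt_poly_eval_inverse_nonzero:
  assumes "u \<noteq> 0"
  shows "qt_poly_eval u (inverse qq) (inverse tt) \<noteq> 0"
proof -
  define g where "g = (\<lambda>c. poly (map_poly (\<lambda>r. to_fract [:[:r:]:]) c) (inverse qq))"
  define D where "D = (\<Sum>i\<le>degree u. degree (coeff u i))"
  define d where "d = (\<lambda>c :: rat poly. monom 1 (D - degree c) * reflect_poly c)"
  define V where "V = map_poly d u"
  have nz: "qq \<noteq> 0" "tt \<noteq> 0"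
    by (simp_all add: qq_def tt_def)
  have qq: "poly (map_poly (\<lambda>r. to_fract [:[:r:]:]) c) qq = to_fract [:c:]" for c
  proof (induction c)
    case (pCons a c)
    thus ?case by (simp add: map_poly_pCons qq_def flip: to_fract_add to_fract_mult)
  qed simp
  have tt: "poly (map_poly (\<lambda>c. to_fract [:c:]) v) tt = to_fract v" for v
  proof (induction v)
    case (pCons a v)
    thus ?case by (simp add: map_poly_pCons tt_def flip: to_fract_add to_fract_mult)
  qed simp
  have d: "qq ^ D * g c = to_fract [:d c:]" if "degree c \<le> D" for c
  proof -
    have "qq ^ D * g c = qq ^ (D - degree c) * (qq ^ degree c * g c)"
      using that by (simp flip: power_add mult.assoc)
    also have "qq ^ degree c * g c = to_fract [:reflect_poly c:]"
      using poly_map_poly_inverse[of "\<lambda>r. to_fract [:[:r:]:]" qq c] nz by (simp add: g_def qq)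
    also have "qq ^ k = to_fract [:monom 1 k:]" for k
      by (induction k) (simp_all add: qq_def monom_Suc monom_0 one_pCons[symmetric] flip: to_fract_mult)
    finally show ?thesis by (simp add: d_def flip: to_fract_mult)
  qed
  have g_0: "g 0 = 0"
    by (simp add: g_def)
  have d_0: "d c = 0 \<longleftrightarrow> c = 0" for c
    by (simp add: d_def monom_eq_0_iff)
  have "degree (coeff u i) \<le> D" for i
  proof (cases "i \<le> degree u")
    case True
    thus ?thesis unfolding D_def by (intro member_le_sum) auto
  qed (simp add: coeff_eq_0)
  hence W: "smult (qq ^ D) (map_poly g u) = map_poly (\<lambda>c. to_fract [:c:]) V"
    by (intro poly_eqI) (simp add: V_def coeff_map_poly d_0 d g_0)
  have V: "V \<noteq> 0"
    using assms d_0 by (simp add: V_def map_poly_eq_0_iff)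
  have "tt ^ degree V * (qq ^ D * qt_poly_eval u (inverse qq) (inverse tt))
      = tt ^ degree V * poly (smult (qq ^ D) (map_poly g u)) (inverse tt)"
    by (simp add: qt_poly_eval_def g_def)
  also have "\<dots> = to_fract (reflect_poly V)"
    using poly_map_poly_inverse[of "\<lambda>c. to_fract [:c:]" tt V] nz by (simp add: W tt)
  also have "\<dots> \<noteq> 0" using V by simp
  finally show ?thesis by auto
qed

text \<open>The substitution of \<open>q\<^sup>-\<^sup>1, t\<^sup>-\<^sup>1\<close> for q and t in a rational function\<close>

definition qt_invert :: "qt \<Rightarrow> qt" where
  "qt_invert x = (THE y. \<exists>u v. v \<noteq> 0 \<and> x = Fract u v \<and>
     y = qt_poly_eval u (inverse qq) (inverse tt) / qt_poly_eval v (inverse qq) (inverse tt))"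

lemma qt_invert_Fract:
  assumes "v \<noteq> 0"
  shows "qt_invert (Fract u v) =
    qt_poly_eval u (inverse qq) (inverse tt) / qt_poly_eval v (inverse qq) (inverse tt)"
  unfolding qt_invert_def
proof (rule the_equality)
  fix y
  assume "\<exists>u' v'. v' \<noteq> 0 \<and> Fract u v = Fract u' v' \<and>
    y = qt_poly_eval u' (inverse qq) (inverse tt) / qt_poly_eval v' (inverse qq) (inverse tt)"
  thus "y = qt_poly_eval u (inverse qq) (inverse tt) / qt_poly_eval v (inverse qq) (inverse tt)"
    using assms
    by (auto simp: qt_poly_eval_inverse_nonzero frac_eq_eq eq_fract simp flip: qt_poly_eval_mult)
qed (use assms in blast)

lemma qt_invert_add: "qt_invert (x + y) = qt_invert x + qt_invert y"
  by (cases x, cases y)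
     (simp add: qt_invert_Fract qt_poly_eval_inverse_nonzero qt_poly_eval_add qt_poly_eval_mult
        add_frac_eq)

lemma qt_invert_mult: "qt_invert (x * y) = qt_invert x * qt_invert y"
  by (cases x, cases y)
     (simp add: qt_invert_Fract qt_poly_eval_mult)

lemma qt_invert_qq: "qt_invert qq = inverse qq"
  and qt_invert_tt: "qt_invert tt = inverse tt"
proof -
  have one: "to_fract [:[:1 :: rat:]:] = 1"
    by (simp flip: one_pCons)
  have "qt_poly_eval 1 a b = 1" "qt_poly_eval [:[:0, 1:]:] a b = a" "qt_poly_eval [:0, 1:] a b = b"
    for a b
    by (simp_all add: qt_poly_eval_def map_poly_pCons map_poly_1' one)
  thus "qt_invert qq = inverse qq" "qt_invert tt = inverse tt"
    using qt_invert_Fract[of 1 "[:[:0, 1:]:]"] qt_invert_Fract[of 1 "[:0, 1:]"]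
    by (simp_all add: qq_def tt_def to_fract_def)
qed


section \<open>Multi-symmetric functions\<close>

text \<open>
  A multi-partition is a list of partitions. Its components, and accordingly the
  alphabets, are numbered from 0, so that the alphabet usually written \<open>x\<^sup>(\<^sup>i\<^sup>)\<close> is
  \<open>alphabet (i - 1)\<close>, with variables \<open>(i - 1, 0), (i - 1, 1), \<dots>\<close>.
\<close>

type_synonym msf = "(nat \<times> nat, qt) mfps"

definition alphabet :: "nat \<Rightarrow> (nat \<times> nat) set" where
  "alphabet i = {i} \<times> UNIV"

definition multi_partitions :: "nat \<Rightarrow> nat list list set" where
  "multi_partitions n = {L. length L = n \<and> (\<forall>l\<in>set L. is_partition l)}"

definition multi_monomial :: "nat \<Rightarrow> nat list list \<Rightarrow> msf" where
  "multi_monomial n L = (\<Prod>i<n. monomial_sym (alphabet i) (L ! i))"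

definition multi_power_sum :: "nat \<Rightarrow> nat list list \<Rightarrow> msf" where
  "multi_power_sum n L = (\<Prod>k<n. power_sum_sym (\<Union>i\<le>k. alphabet i) (L ! k))"

definition multi_sym_space :: "nat \<Rightarrow> msf set" where
  "multi_sym_space n = mfps.span (multi_monomial n ` multi_partitions n)"

text \<open>\<open>take j\<close> is total, which amounts to padding the partitions with zeros.\<close>

definition dominated :: "nat \<Rightarrow> nat list list \<Rightarrow> nat list list \<Rightarrow> bool" where
  "dominated n M L \<longleftrightarrow> (\<forall>k<n. \<forall>j.
     (\<Sum>i<k. sum_list (M ! i)) + sum_list (take j (M ! k))
       \<le> (\<Sum>i<k. sum_list (L ! i)) + sum_list (take j (L ! k)))"

definition strictly_dominated :: "nat \<Rightarrow> nat list list \<Rightarrow> nat list list \<Rightarrow> bool" where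
  "strictly_dominated n M L \<longleftrightarrow> dominated n M L \<and> M \<noteq> L"

definition bar_size :: "nat \<Rightarrow> nat list list \<Rightarrow> nat" where
  "bar_size n L = (\<Sum>i<n. sum_list (L ! i))"

text \<open>The weight \<open>i - 1\<close> of the \<open>i\<close>-th component becomes \<open>i\<close> when numbering from 0.\<close>

definition bar_n :: "nat \<Rightarrow> nat list list \<Rightarrow> nat" where
  "bar_n n L = (\<Sum>i<n. i * sum_list (L ! i))"


section \<open>The scalar product and the multi-Macdonald polynomials\<close>

definition power_sum_norm :: "nat \<Rightarrow> nat list list \<Rightarrow> qt" where
  "power_sum_norm n L =
     qq powi ((int n - 1) * int (bar_size n L) - int (bar_n n L))
     * (\<Prod>i<n. of_nat (zee (L ! i)))
     * (\<Prod>r\<leftarrow>L ! (n - 1). (1 - qq ^ r) / (1 - tt ^ r))"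

text \<open>
  The coordinate of a multi-symmetric function along a power sum, with respect to the basis
  of all multi-power sums.
\<close>

definition power_sum_coeff :: "nat \<Rightarrow> msf \<Rightarrow> nat list list \<Rightarrow> qt" where
  "power_sum_coeff n f L =
     mfps.representation (multi_power_sum n ` multi_partitions n) f (multi_power_sum n L)"

definition scalar_product :: "nat \<Rightarrow> msf \<Rightarrow> msf \<Rightarrow> qt" where
  "scalar_product n f g =
     (\<Sum>L | L \<in> multi_partitions n \<and> power_sum_coeff n f L \<noteq> 0.
      \<Sum>M | M \<in> multi_partitions n \<and> power_sum_coeff n g M \<noteq> 0.
        power_sum_coeff n f L * power_sum_coeff n g M
          * (if L = M then power_sum_norm n L else 0))"

definition is_basis_family :: "nat \<Rightarrow> (nat list list \<Rightarrow> msf) \<Rightarrow> bool" where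
  "is_basis_family n P \<longleftrightarrow>
     inj_on P (multi_partitions n) \<and>
     mfps.independent (P ` multi_partitions n) \<and>
     mfps.span (P ` multi_partitions n) = multi_sym_space n"

definition multi_macdonald :: "nat \<Rightarrow> (nat list list \<Rightarrow> msf) \<Rightarrow> bool" where
  "multi_macdonald n P \<longleftrightarrow>
     is_basis_family n P \<and>
     (\<forall>L\<in>multi_partitions n. P L - multi_monomial n L \<in>
        mfps.span (multi_monomial n ` {M \<in> multi_partitions n. strictly_dominated n M L})) \<and>
     (\<forall>L\<in>multi_partitions n. \<forall>M\<in>multi_partitions n.
        L \<noteq> M \<longrightarrow> scalar_product n (P L) (P M) = 0)"

text \<open>
  The plethystic substitution \<open>f[q\<^bsup>n-1\<^esup>X\<^sup>(\<^sup>1\<^sup>), \<dots>, X\<^sup>(\<^sup>n\<^sup>)]\<close> multiplies all variables of one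
  alphabet by a power of q and leaves the coefficients of \<open>f\<close> unchanged. By the lemmas on
  \<open>rescale_vars\<close> it is an algebra homomorphism, with the expected value on the power sums
  of each alphabet.
\<close>

definition plethysm_q :: "nat \<Rightarrow> msf \<Rightarrow> msf" where
  "plethysm_q n = rescale_vars (\<lambda>(i, j). qq powi (int n - 1 - int i))"

end

theory Submission
  imports Defs
begin

text \<open>
  Let \<open>\<sigma>\<close> be the inversion of q and t followed by the inverse of the plethystic substitution. It is
  a semilinear ring homomorphism multiplying every \<open>m\<^sub>\<lambda>\<close> by a power of q, and the claim is that
  \<open>P\<^sub>\<lambda>\<close> is an eigenvector of it. The map \<open>\<sigma>\<close> does not preserve the scalar product up to factors, but
  it does against one family: let \<open>M\<^sub>\<mu>\<close> be \<open>m\<^sub>\<mu>\<close> with its first alphabet replaced by the union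
  of all alphabets. A product of the power sums of the union and of the alphabets
  \<open>x\<^sup>(\<^sup>2\<^sup>), \<dots>, x\<^sup>(\<^sup>n\<^sup>)\<close> is compatible with \<open>\<sigma>\<close>, because the adjoints of multiplication by these
  power sums are derivations which commute with \<open>\<sigma>\<close> up to a scalar; hence \<open>\<langle>\<sigma> f, M\<^sub>\<mu>\<rangle>\<close> is a multiple
  of the inversion of \<open>\<langle>f, M\<^sub>\<mu>\<rangle>\<close>. Since \<open>M\<^sub>\<mu>\<close> is unitriangular over the \<open>m\<^sub>\<nu>\<close> with
  \<open>\<nu> \<le> \<mu>\<close>, the function \<open>\<sigma> P\<^sub>\<lambda>\<close> is, like \<open>P\<^sub>\<lambda>\<close>, orthogonal to all \<open>m\<^sub>\<mu>\<close> with \<open>\<mu> < \<lambda>\<close>, and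
  triangularity determines it up to a scalar.
\<close>

section \<open>Monomial symmetric functions and power sums\<close>

text \<open>Number the alphabets from 0, so that sigma scales p_r(x^i) by q^((i+1-n)r). If D is the
  adjoint of multiplication by v, with constants e_i = D p_s(x^i), then D sigma = c sigma D amounts
  to q^((i+1-n)s) e_i = c bar(e_i) for all i and s, where bar inverts q and t. For v = p_r(x^j) with
  j >= 1 only s = r and i = j-1, j, j+1 matter. If j < n-1, the constants are -r q^((n-j)r), r
  q^((n-j)r) + r q^((n-1-j)r) and -r q^((n-1-j)r), and all three equations give c = q^((n-j)r). If j
  = n-1, the middle one is r(1-(qt)^r)/(1-t^r), with the same c. For the union of all alphabets only
  i = n-1 matters, and c = (q/t)^r. For v = p_r(x^0) and n > 1, however, the alphabets 0 and 1 ask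
  for q^((n-1)r) and q^(nr): this conflict is why the first alphabet is merged with the others. As
  sigma is only semilinear, the passage from power sums to monomial functions must use rational
  coefficients and terms that share one factor c.\<close>

definition exponents :: "('v \<Rightarrow>\<^sub>0 nat) \<Rightarrow> nat multiset" where
  "exponents m = image_mset (Poly_Mapping.lookup m) (mset_set (Poly_Mapping.keys m))"

definition partition_of :: "nat multiset \<Rightarrow> nat list" where
  "partition_of M = rev (sorted_list_of_multiset M)"

lemma mset_partition_of [simp]: "mset (partition_of M) = M"
  by (simp add: partition_of_def)

lemma is_partition_partition_of: "0 \<notin># M \<Longrightarrow> is_partition (partition_of M)"
  by (simp add: partition_of_def is_partition_def sorted_wrt_rev)

lemma partition_of_mset: "is_partition l \<Longrightarrow> partition_of (mset l) = l"
proof -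
  assume "is_partition l"
  hence "sort l = rev l"
    by (intro properties_for_sort) (auto simp: is_partition_def sorted_wrt_rev)
  thus ?thesis by (simp add: partition_of_def)
qed

lemma mfps_nth_monomial_sym:
  "mfps_nth (monomial_sym A l) m = (if Poly_Mapping.keys m \<subseteq> A \<and> exponents m = mset l then 1 else 0)"
  by (simp add: monomial_sym_def Abs_mfps_inverse exponents_def)

lemma mfps_nth_power_sum:
  "mfps_nth (power_sum A r) m = (if \<exists>v\<in>A. m = Poly_Mapping.single v r then 1 else 0)"
  by (simp add: power_sum_def Abs_mfps_inverse)

lemma mfps_nth_sum: "mfps_nth (sum f S) m = (\<Sum>x\<in>S. mfps_nth (f x) m)"
  by (induction S rule: infinite_finite_induct) (auto simp: plus_mfps.rep_eq zero_mfps.rep_eq)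

lemma mfps_nth_scale [simp]: "mfps_nth (mfps_scale c f) m = c * mfps_nth f m"
  by (simp add: mfps_scale.rep_eq)

lemma mfps_scale_mult_left [simp]: "mfps_scale c f * g = mfps_scale c (f * g)"
  by (rule mfps_eqI) (simp add: times_mfps.rep_eq sum_distrib_left case_prod_unfold mult.assoc)

lemma mfps_scale_mult_right [simp]: "f * mfps_scale c g = mfps_scale c (f * g)"
  by (metis mfps_scale_mult_left mult.commute)

lemma monomial_sym_cong: "mset l = mset l' \<Longrightarrow> monomial_sym A l = monomial_sym A l'"
  by (simp add: monomial_sym_def)

lemma monomial_sym_Nil [simp]: "monomial_sym A [] = 1"
proof -
  have "Poly_Mapping.keys m \<subseteq> A \<and> exponents m = mset [] \<longleftrightarrow> m = 0" for m :: "'a \<Rightarrow>\<^sub>0 nat"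
    by (auto simp: exponents_def mset_set_empty_iff intro: poly_mapping_eqI simp: in_keys_iff)
  thus ?thesis by (intro mfps_eqI) (simp add: mfps_nth_monomial_sym one_mfps.rep_eq)
qed

text \<open>
  In a product \<open>power_sum A r * monomial_sym A l\<close>, a monomial with exponents \<open>T\<close>
  arises once for every entry of \<open>T\<close> from which subtracting \<open>r\<close> gives the exponents \<open>M\<close> of \<open>l\<close>.
\<close>

definition reducible :: "nat \<Rightarrow> nat multiset \<Rightarrow> nat multiset \<Rightarrow> nat \<Rightarrow> bool" where
  "reducible r M T x \<longleftrightarrow> r \<le> x \<and> T - {#x#} + (if x = r then {#} else {#x - r#}) = M"

definition pieri_coeff :: "nat \<Rightarrow> nat multiset \<Rightarrow> nat multiset \<Rightarrow> nat" where
  "pieri_coeff r M T = size (filter_mset (reducible r M T) T)"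

text \<open>Shapes in which r is added to an existing part. Multiplication by a power sum of degree
  r yields these and the shape with r as a new part.\<close>

definition pieri_shapes :: "nat \<Rightarrow> nat multiset \<Rightarrow> nat multiset set" where
  "pieri_shapes r M = (\<lambda>y. M - {#y#} + {#y + r#}) ` set_mset M"

text \<open>Undo the reduction at an entry x: if x = r, the entry was a new part; otherwise it came
  from the part x - r.\<close>

lemma pieri_coeff_shapes:
  assumes "pieri_coeff r M T \<noteq> 0"
  shows "T \<in> insert (add_mset r M) (pieri_shapes r M)"
proof -
  obtain x where x: "x \<in># T" "r \<le> x" "T - {#x#} + (if x = r then {#} else {#x - r#}) = M"
  proof -
    from assms obtain x where "x \<in># filter_mset (reducible r M T) T"
      unfolding pieri_coeff_def by (metis multiset_nonemptyE size_empty)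
    thus ?thesis using that unfolding reducible_def by fastforce
  qed
  show ?thesis
  proof (cases "x = r")
    case True
    thus ?thesis using x by auto
  next
    case False
    have "T = M - {#x - r#} + {#x - r + r#}"
      using x False by (auto simp: insert_DiffM)
    moreover have "x - r \<in># M" using x False by auto
    ultimately show ?thesis unfolding pieri_shapes_def by blast
  qed
qed

text \<open>In characteristic 0 this coefficient can be divided by, so the product formula can be
  solved for the monomial function that has r as a new part.\<close>

lemma pieri_coeff_pos: "pieri_coeff r M (add_mset r M) > 0"
  by (auto simp: pieri_coeff_def reducible_def nonempty_has_size[symmetric])

text \<open>The case distinction records that a variable whose exponent drops to 0 leaves the
  support and contributes no entry.\<close>

lemma exponents_minus_single:
  assumes "r > 0" "r \<le> Poly_Mapping.lookup m v"
  defines "x \<equiv> Poly_Mapping.lookup m v"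
  shows "exponents (m - Poly_Mapping.single v r)
       = exponents m - {#x#} + (if x = r then {#} else {#x - r#})"
proof -
  let ?m = "m - Poly_Mapping.single v r"
  let ?K = "Poly_Mapping.keys m - {v}"
  have v: "v \<in> Poly_Mapping.keys m" using assms by (auto simp: in_keys_iff)
  have lk: "Poly_Mapping.lookup ?m w = (if w = v then x - r else Poly_Mapping.lookup m w)" for w
    by (simp add: lookup_minus lookup_single when_def x_def)
  have keys: "Poly_Mapping.keys ?m = (if x = r then ?K else insert v ?K)"
    using v assms(1,2) lk x_def by (auto simp: in_keys_iff split: if_splits)
  have "image_mset (Poly_Mapping.lookup ?m) (mset_set ?K) = image_mset (Poly_Mapping.lookup m) (mset_set ?K)"
    by (intro image_mset_cong) (auto simp: lk)
  moreover have "exponents m = add_mset x (image_mset (Poly_Mapping.lookup m) (mset_set ?K))"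
    using v unfolding exponents_def x_def
    by (subst insert_Diff[OF v, symmetric], subst mset_set.insert) auto
  ultimately show ?thesis
    unfolding exponents_def[of ?m] keys by (simp add: lk del: insert_Diff_single)
qed

text \<open>The factor taken from the power sum is a single power of a variable v, which determines
  the cofactor. As r > 0, the variables v in question lie in the support of m, so the sum is
  finite.\<close>

lemma mfps_nth_power_sum_mult:
  fixes f :: "('v, 'a::comm_ring_1) mfps"
  assumes "r > 0"
  shows "mfps_nth (power_sum A r * f) m =
    (\<Sum>v | v \<in> A \<and> r \<le> Poly_Mapping.lookup m v. mfps_nth f (m - Poly_Mapping.single v r))"
proof -
  let ?V = "{v \<in> A. r \<le> Poly_Mapping.lookup m v}"
  have split: "Poly_Mapping.single v r + (m - Poly_Mapping.single v r) = m"
    if "r \<le> Poly_Mapping.lookup m v" for v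
    using that by (intro poly_mapping_eqI) (auto simp: lookup_add lookup_minus lookup_single when_def)
  have "mfps_nth (power_sum A r * f) m =
     (\<Sum>(a, b)\<in>(\<lambda>v. (Poly_Mapping.single v r, m - Poly_Mapping.single v r)) ` ?V.
        mfps_nth (power_sum A r) a * mfps_nth f b)"
    unfolding times_mfps.rep_eq
  proof (rule sum.mono_neutral_right[OF finite_monomial_splits])
    let ?I = "(\<lambda>v. (Poly_Mapping.single v r, m - Poly_Mapping.single v r)) ` ?V"
    show "?I \<subseteq> {(a, b). a + b = m}" using split by auto
    have zero: "mfps_nth (power_sum A r) a = (0 :: 'a)" if "a + b = m" "(a, b) \<notin> ?I" for a b
    proof (rule ccontr)
      assume "mfps_nth (power_sum A r) a \<noteq> (0 :: 'a)"
      then obtain v where v: "v \<in> A" "a = Poly_Mapping.single v r"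
        by (auto simp: mfps_nth_power_sum split: if_splits)
      have "(a, b) \<in> ?I"
        by (rule image_eqI[of _ _ v]) (use that(1) v in \<open>auto simp: lookup_add\<close>)
      thus False using that(2) by blast
    qed
    show "\<forall>x\<in>{(a, b). a + b = m} - ?I. (case x of (a, b) \<Rightarrow> mfps_nth (power_sum A r) a * mfps_nth f b) = 0"
    proof
      fix x assume x: "x \<in> {(a, b). a + b = m} - ?I"
      obtain a b where "x = (a, b)" by (cases x)
      thus "(case x of (a, b) \<Rightarrow> mfps_nth (power_sum A r) a * mfps_nth f b) = 0"
        using zero[of a b] x by simp
    qed
  qed
  also have "\<dots> = (\<Sum>v\<in>?V. mfps_nth f (m - Poly_Mapping.single v r))"
  proof (subst sum.reindex)
    show "inj_on (\<lambda>v. (Poly_Mapping.single v r, m - Poly_Mapping.single v r)) ?V"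
      using assms by (auto intro!: inj_onI dest: arg_cong[where f = Poly_Mapping.keys])
  qed (auto simp: mfps_nth_power_sum intro!: sum.cong)
  finally show ?thesis .
qed

lemma power_sum_mult_monomial_sym:
  fixes A :: "'v set"
  assumes "r > 0"
  shows "(power_sum A r * monomial_sym A l :: ('v, 'b::comm_ring_1) mfps) =
    (\<Sum>T\<in>insert (add_mset r (mset l)) (pieri_shapes r (mset l)).
       mfps_scale (of_nat (pieri_coeff r (mset l) T)) (monomial_sym A (partition_of T)))"
    (is "_ = sum ?g ?S")
proof (rule mfps_eqI)
  fix m :: "'v \<Rightarrow>\<^sub>0 nat"
  let ?p = "power_sum A r * monomial_sym A l :: ('v, 'b) mfps"
  let ?V = "{v. v \<in> A \<and> r \<le> Poly_Mapping.lookup m v}"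
  have lhs: "mfps_nth ?p m =
    (\<Sum>v\<in>?V. if Poly_Mapping.keys (m - Poly_Mapping.single v r) \<subseteq> A \<and>
        exponents (m - Poly_Mapping.single v r) = mset l then 1 else 0 :: 'b)"
    by (simp add: mfps_nth_power_sum_mult[OF assms] mfps_nth_monomial_sym)
  have fin: "finite ?S" by (simp add: pieri_shapes_def)
  \<comment> \<open>Monomial functions of different shapes have disjoint supports, so only T =
    \<open>exponents m\<close> contributes at m.\<close>
  have rhs: "mfps_nth (sum ?g ?S) m = (if Poly_Mapping.keys m \<subseteq> A
      then of_nat (pieri_coeff r (mset l) (exponents m)) else 0)"
  proof (cases "exponents m \<in> ?S")
    case True
    have "mfps_nth (sum ?g ?S) m = (\<Sum>T\<in>?S. if T = exponents m then
       (if Poly_Mapping.keys m \<subseteq> A then of_nat (pieri_coeff r (mset l) T) else 0) else 0)"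
      unfolding mfps_nth_sum by (intro sum.cong) (auto simp: mfps_nth_monomial_sym)
    thus ?thesis using True fin by (simp only: sum.delta if_True)
  next
    case False
    hence "pieri_coeff r (mset l) (exponents m) = 0" using pieri_coeff_shapes by blast
    moreover have "mfps_nth (sum ?g ?S) m = 0"
      unfolding mfps_nth_sum using False by (intro sum.neutral) (auto simp: mfps_nth_monomial_sym)
    ultimately show ?thesis by simp
  qed
  have keys: "Poly_Mapping.keys (m - Poly_Mapping.single v r) \<subseteq> A \<longleftrightarrow> Poly_Mapping.keys m \<subseteq> A" if "v \<in> ?V" for v
  proof -
    have "insert v (Poly_Mapping.keys (m - Poly_Mapping.single v r)) = insert v (Poly_Mapping.keys m)"
      by (auto simp: in_keys_iff lookup_minus lookup_single when_def split: if_splits)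
    moreover have "v \<in> A" using that by simp
    ultimately show ?thesis by (metis insert_subset)
  qed
  show "mfps_nth ?p m = mfps_nth (sum ?g ?S) m"
  proof (cases "Poly_Mapping.keys m \<subseteq> A")
    case True
    have "?V \<subseteq> Poly_Mapping.keys m" using assms by (auto simp: in_keys_iff)
    hence "finite ?V" by (rule finite_subset) simp
    hence "(\<Sum>v\<in>?V. if exponents (m - Poly_Mapping.single v r) = mset l then 1 else 0 :: 'b) =
        of_nat (card {v \<in> ?V. exponents (m - Poly_Mapping.single v r) = mset l})"
      by (subst sum.inter_filter[symmetric]) auto
    moreover have "mfps_nth ?p m =
        (\<Sum>v\<in>?V. if exponents (m - Poly_Mapping.single v r) = mset l then 1 else 0 :: 'b)"
      unfolding lhs using True keys by (intro sum.cong refl if_cong) auto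
    ultimately have "mfps_nth ?p m =
        of_nat (card {v \<in> ?V. exponents (m - Poly_Mapping.single v r) = mset l})"
      by simp
    also have "{v \<in> ?V. exponents (m - Poly_Mapping.single v r) = mset l} =
      {v \<in> Poly_Mapping.keys m. reducible r (mset l) (exponents m) (Poly_Mapping.lookup m v)}"
      using True assms
      by (auto simp: reducible_def in_keys_iff exponents_minus_single)
    also have "card \<dots> = pieri_coeff r (mset l) (exponents m)"
      unfolding pieri_coeff_def by (subst (2) exponents_def) (simp add: filter_mset_image_mset)
    finally show ?thesis using True rhs by simp
  next
    case False
    hence "\<not> Poly_Mapping.keys (m - Poly_Mapping.single v r) \<subseteq> A" if "v \<in> ?V" for v
      using keys[OF that] by blast
    hence "mfps_nth ?p m = 0" unfolding lhs by (intro sum.neutral) auto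
    thus ?thesis using rhs False by simp
  qed
qed

text \<open>Induction on the number of parts: p_r m_l' is a nonzero multiple of m_l, with l = r #
  l', plus monomial functions with one part fewer, and this is solved for m_l. The index d tracks
  the degree, and the fixed factor h allows the principle to be applied to one alphabet after
  another. Closure is asked only under differences and under scaling by natural numbers and their
  inverses, because the property for which the principle is designed survives only scalars fixed by
  \<open>qt_invert\<close>.\<close>

lemma monomial_sym_induct:
  fixes A :: "'v set" and h :: "('v, 'a::field_char_0) mfps"
  assumes base: "\<Phi> 0 h"
    and step: "\<And>d r f. r > 0 \<Longrightarrow> \<Phi> d f \<Longrightarrow> \<Phi> (d + r) (power_sum A r * f)"
    and diff: "\<And>d f g. \<Phi> d f \<Longrightarrow> \<Phi> d g \<Longrightarrow> \<Phi> d (f - g)"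
    and mult: "\<And>d f k. \<Phi> d f \<Longrightarrow> \<Phi> d (mfps_scale (of_nat k) f)"
    and divide: "\<And>d f k. \<Phi> d f \<Longrightarrow> \<Phi> d (mfps_scale (inverse (of_nat k)) f)"
    and l: "0 \<notin> set l"
  shows "\<Phi> (sum_list l) (monomial_sym A l * h)"
  using l
proof (induction "length l" arbitrary: l)
  case 0
  thus ?case using base by simp
next
  case (Suc s)
  then obtain r l' where l: "l = r # l'" by (cases l) auto
  define M where "M = mset l'"
  define d where "d = sum_list l"
  have r: "r > 0" and l': "length l' = s" "0 \<notin> set l'" using Suc.prems Suc.hyps(2) by (auto simp: l)
  have d: "sum_list l' + r = d" by (simp add: d_def l)
  let ?c = "pieri_coeff r M (add_mset r M)"
  let ?U = "pieri_shapes r M - {add_mset r M}"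
  have shapes: "\<Phi> d (monomial_sym A (partition_of T) * h)" if T: "T \<in> ?U" for T
  proof -
    obtain y where y: "y \<in># M" "T = M - {#y#} + {#y + r#}"
      using T by (auto simp: pieri_shapes_def)
    \<comment> \<open>Adding r to an existing part preserves the number of parts, so the induction
      hypothesis applies to T.\<close>
    have "size T = s" using y l' M_def by (simp add: size_Diff_singleton)
         (metis Suc_pred length_pos_if_in_set set_mset_mset size_mset)
    hence "length (partition_of T) = s" by (metis mset_partition_of size_mset)
    moreover have "0 \<notin># T"
      using y l' r unfolding M_def by (auto dest: in_diffD)
    hence "0 \<notin> set (partition_of T)" by (metis mset_partition_of set_mset_mset)
    moreover have "sum_mset T = d"
      using y d unfolding M_def
      by (simp add: sum_mset_sum_list[symmetric] sum_mset.remove)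
    hence "sum_list (partition_of T) = d" by (metis mset_partition_of sum_mset_sum_list)
    ultimately show ?thesis using Suc.hyps(1)[of "partition_of T"] by simp
  qed
  \<comment> \<open>The terms are subtracted one by one, as closure is available only for
    differences.\<close>
  have sub: "\<Phi> d (f - (\<Sum>T\<in>S. mfps_scale (of_nat (pieri_coeff r M T)) (monomial_sym A (partition_of T) * h)))"
    if "finite S" "S \<subseteq> ?U" "\<Phi> d f" for S f
    using that
  proof (induction S)
    case (insert T S)
    have "\<Phi> d (f - (\<Sum>T\<in>S. mfps_scale (of_nat (pieri_coeff r M T)) (monomial_sym A (partition_of T) * h))
        - mfps_scale (of_nat (pieri_coeff r M T)) (monomial_sym A (partition_of T) * h))"
      using insert by (intro diff[OF insert.IH mult[OF shapes]]) auto
    thus ?case using insert.hyps by (simp add: diff_diff_eq add.commute)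
  qed simp
  let ?m = "monomial_sym A l * h"
  have fin: "finite ?U" by (simp add: pieri_shapes_def)
  have "power_sum A r * (monomial_sym A l' * h) =
     mfps_scale (of_nat ?c) ?m +
     (\<Sum>T\<in>?U. mfps_scale (of_nat (pieri_coeff r M T)) (monomial_sym A (partition_of T) * h))"
  proof -
    have "monomial_sym A (partition_of (add_mset r M)) = (monomial_sym A l :: ('v, 'a) mfps)"
      by (rule monomial_sym_cong) (simp add: l M_def)
    hence "(power_sum A r * monomial_sym A l' :: ('v, 'a) mfps) =
       mfps_scale (of_nat ?c) (monomial_sym A l) +
       (\<Sum>T\<in>?U. mfps_scale (of_nat (pieri_coeff r M T)) (monomial_sym A (partition_of T)))"
      unfolding power_sum_mult_monomial_sym[OF r] M_def[symmetric]
      by (subst sum.insert_remove) (simp_all add: pieri_shapes_def)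
    thus ?thesis by (simp add: mult.assoc[symmetric] distrib_right sum_distrib_right)
  qed
  moreover have "\<Phi> d (power_sum A r * (monomial_sym A l' * h))"
    using step[OF r Suc.hyps(1)[OF l'(1)[symmetric] l'(2)]] d by simp
  ultimately have "\<Phi> d (mfps_scale (of_nat ?c) ?m)"
    using sub[OF fin subset_refl, of "power_sum A r * (monomial_sym A l' * h)"] by simp
  from divide[OF this, of ?c] have "\<Phi> d ?m"
    using pieri_coeff_pos[of r M] by simp
  thus ?case by (simp add: d_def)
qed

section \<open>The basis of monomial functions\<close>

lift_definition restrict_monomial :: "'v set \<Rightarrow> ('v \<Rightarrow>\<^sub>0 nat) \<Rightarrow> ('v \<Rightarrow>\<^sub>0 nat)" is
  "\<lambda>A f v. if v \<in> A then f v else 0"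
  by (rule finite_subset) auto

lemma keys_restrict_monomial [simp]:
  "Poly_Mapping.keys (restrict_monomial A m) = Poly_Mapping.keys m \<inter> A"
  by (auto simp: in_keys_iff restrict_monomial.rep_eq split: if_splits)

lemma restrict_restrict_monomial [simp]:
  "restrict_monomial A (restrict_monomial B m) = restrict_monomial (A \<inter> B) m"
  by (rule poly_mapping_eqI) (simp add: restrict_monomial.rep_eq)

lemma restrict_monomial_add: "restrict_monomial A (a + b) = restrict_monomial A a + restrict_monomial A b"
  by (rule poly_mapping_eqI) (simp add: restrict_monomial.rep_eq lookup_add)

lemma restrict_monomial_id: "Poly_Mapping.keys m \<subseteq> A \<Longrightarrow> restrict_monomial A m = m"
  by (rule poly_mapping_eqI) (auto simp: restrict_monomial.rep_eq in_keys_iff)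

lemma restrict_monomial_0: "Poly_Mapping.keys m \<inter> A = {} \<Longrightarrow> restrict_monomial A m = 0"
  by (rule poly_mapping_eqI) (auto simp: restrict_monomial.rep_eq in_keys_iff)

text \<open>A monomial has only one factorization into a part supported in A and a part supported in
  B.\<close>

lemma mfps_nth_mult_disjoint:
  fixes f g :: "('v, 'a::comm_ring_1) mfps"
  assumes "A \<inter> B = {}"
    and f: "\<And>m. mfps_nth f m \<noteq> 0 \<Longrightarrow> Poly_Mapping.keys m \<subseteq> A"
    and g: "\<And>m. mfps_nth g m \<noteq> 0 \<Longrightarrow> Poly_Mapping.keys m \<subseteq> B"
  shows "mfps_nth (f * g) m = (if Poly_Mapping.keys m \<subseteq> A \<union> B
     then mfps_nth f (restrict_monomial A m) * mfps_nth g (restrict_monomial B m) else 0)"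
proof -
  have unique: "a = restrict_monomial A m \<and> b = restrict_monomial B m \<and> Poly_Mapping.keys m \<subseteq> A \<union> B"
    if "a + b = m" "mfps_nth f a * mfps_nth g b \<noteq> 0" for a b
  proof -
    have "mfps_nth f a \<noteq> 0" "mfps_nth g b \<noteq> 0" using that(2) by auto
    hence a: "Poly_Mapping.keys a \<subseteq> A" and b: "Poly_Mapping.keys b \<subseteq> B"
      by (auto dest!: f g)
    have "restrict_monomial A m = a"
      using a b assms(1) by (subst that(1)[symmetric], subst restrict_monomial_add,
          subst restrict_monomial_id[OF a], subst restrict_monomial_0) auto
    moreover have "restrict_monomial B m = b"
      using a b assms(1) by (subst that(1)[symmetric], subst restrict_monomial_add,
          subst restrict_monomial_id[OF b], subst restrict_monomial_0) auto
    moreover have "Poly_Mapping.keys m \<subseteq> A \<union> B"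
      using a b keys_add[of a b] that(1) by blast
    ultimately show ?thesis by simp
  qed
  show ?thesis
  proof (cases "Poly_Mapping.keys m \<subseteq> A \<union> B")
    case True
    have "restrict_monomial A m + restrict_monomial B m = m"
      using True assms(1)
      by (intro poly_mapping_eqI) (auto simp: lookup_add restrict_monomial.rep_eq in_keys_iff)
    hence "(\<Sum>(a, b) | a + b = m. mfps_nth f a * mfps_nth g b) =
        (\<Sum>(a, b)\<in>{(restrict_monomial A m, restrict_monomial B m)}. mfps_nth f a * mfps_nth g b)"
    proof (intro sum.mono_neutral_right finite_monomial_splits ballI)
      fix x assume x: "x \<in> {(a, b). a + b = m} - {(restrict_monomial A m, restrict_monomial B m)}"
      obtain a b where ab: "x = (a, b)" by (cases x)
      hence "mfps_nth f a * mfps_nth g b = 0" using unique[of a b] x by blast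
      thus "(case x of (a, b) \<Rightarrow> mfps_nth f a * mfps_nth g b) = 0" by (simp only: ab prod.case)
    qed simp
    thus ?thesis using True by (simp add: times_mfps.rep_eq)
  next
    case False
    have "(\<Sum>(a, b) | a + b = m. mfps_nth f a * mfps_nth g b) = 0"
    proof (intro sum.neutral ballI)
      fix x assume x: "x \<in> {(a, b). a + b = m}"
      obtain a b where ab: "x = (a, b)" by (cases x)
      hence "mfps_nth f a * mfps_nth g b = 0" using unique[of a b] x False by blast
      thus "(case x of (a, b) \<Rightarrow> mfps_nth f a * mfps_nth g b) = 0" by (simp only: ab prod.case)
    qed
    thus ?thesis using False by (simp add: times_mfps.rep_eq)
  qed
qed

text \<open>This serves for products over overlapping alphabets, where a monomial may split in
  several ways and only the existence of a splitting can be used.\<close>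

lemma mfps_nth_prod_nonzero:
  fixes f :: "'i \<Rightarrow> ('v, 'a::comm_ring_1) mfps"
  assumes "finite I" "mfps_nth (prod f I) m \<noteq> 0"
  shows "\<exists>e. m = sum e I \<and> (\<forall>i\<in>I. mfps_nth (f i) (e i) \<noteq> 0)"
  using assms
proof (induction I arbitrary: m rule: finite_induct)
  case empty
  thus ?case by (auto simp: one_mfps.rep_eq split: if_splits)
next
  case (insert i I)
  have "(\<Sum>(a, b) | a + b = m. mfps_nth (f i) a * mfps_nth (prod f I) b) \<noteq> 0"
    using insert.prems insert.hyps by (simp add: times_mfps.rep_eq)
  then obtain a b where ab: "a + b = m" "mfps_nth (f i) a * mfps_nth (prod f I) b \<noteq> 0"
    by (auto elim!: sum.not_neutral_contains_not_neutral)
  hence nz: "mfps_nth (f i) a \<noteq> 0" "mfps_nth (prod f I) b \<noteq> 0" by auto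
  obtain e where e: "b = sum e I" "\<forall>i\<in>I. mfps_nth (f i) (e i) \<noteq> 0"
    using insert.IH[OF nz(2)] by blast
  have "sum (e(i := a)) (insert i I) = a + sum e I"
    using insert.hyps by (simp, intro sum.cong) auto
  thus ?case using ab(1) e nz(1) insert.hyps
    by (intro exI[of _ "e(i := a)"]) auto
qed

section \<open>Coordinates with respect to the monomial functions\<close>

definition alphabets :: "nat \<Rightarrow> (nat \<times> nat) set" where
  "alphabets n = (\<Union>i<n. alphabet i)"

lemma alphabets_Suc: "alphabets (Suc n) = alphabets n \<union> alphabet n"
  by (auto simp: alphabets_def lessThan_Suc)

lemma mfps_nth_multi_monomial:
  "mfps_nth (multi_monomial n L) m =
     (if Poly_Mapping.keys m \<subseteq> alphabets n \<and>
         (\<forall>i<n. exponents (restrict_monomial (alphabet i) m) = mset (L ! i)) then 1 else 0)"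
proof (induction n arbitrary: m)
  case 0
  have "m = 0" if "Poly_Mapping.keys m = {}"
    using that by (auto intro: poly_mapping_eqI simp: in_keys_iff)
  thus ?case by (auto simp: multi_monomial_def alphabets_def one_mfps.rep_eq)
next
  case (Suc n)
  have disj: "alphabets n \<inter> alphabet n = {}" by (auto simp: alphabets_def alphabet_def)
  have 1: "alphabet i \<inter> alphabets n = alphabet i" if "i < n" for i
    using that by (auto simp: alphabets_def)
  let ?Q = "\<lambda>i. exponents (restrict_monomial (alphabet i) m) = mset (L ! i)"
  have "mfps_nth (multi_monomial (Suc n) L) m =
      (if Poly_Mapping.keys m \<subseteq> alphabets n \<union> alphabet n
       then mfps_nth (multi_monomial n L) (restrict_monomial (alphabets n) m)
            * mfps_nth (monomial_sym (alphabet n) (L ! n)) (restrict_monomial (alphabet n) m) else 0)"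
    unfolding multi_monomial_def prod.lessThan_Suc
    by (rule mfps_nth_mult_disjoint[OF disj])
       (auto simp: Suc[unfolded multi_monomial_def] mfps_nth_monomial_sym split: if_splits)
  also have "mfps_nth (multi_monomial n L) (restrict_monomial (alphabets n) m) =
      (if \<forall>i<n. exponents (restrict_monomial (alphabet i) m) = mset (L ! i) then 1 else 0)"
    using 1 by (simp add: Suc)
  also have "mfps_nth (monomial_sym (alphabet n) (L ! n)) (restrict_monomial (alphabet n) m) =
      (if exponents (restrict_monomial (alphabet n) m) = mset (L ! n) then 1 else 0 :: qt)"
    by (simp add: mfps_nth_monomial_sym)
  finally have eq: "mfps_nth (multi_monomial (Suc n) L) m =
      (if Poly_Mapping.keys m \<subseteq> alphabets n \<union> alphabet n \<and> (\<forall>i<n. ?Q i) \<and> ?Q n then 1 else 0)"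
    by (cases "?Q n"; cases "\<forall>i<n. ?Q i"; cases "Poly_Mapping.keys m \<subseteq> alphabets n \<union> alphabet n")
       (simp_all only: if_True if_False simp_thms mult_1_left mult_1_right mult_zero_left mult_zero_right)
  have all: "(\<forall>i<Suc n. ?Q i) \<longleftrightarrow> (\<forall>i<n. ?Q i) \<and> ?Q n"
    by (subst All_less_Suc) (rule conj_commute)
  show ?case unfolding all alphabets_Suc by (rule eq)
qed

text \<open>A representative of the monomials of \<open>multi_monomial n L\<close>: the parts of
  each component become the exponents of the leading variables of its alphabet. Reading the
  coefficient there is the coordinate functional dual to the monomial basis.\<close>

lift_definition monomial_of :: "nat \<Rightarrow> nat list list \<Rightarrow> (nat \<times> nat \<Rightarrow>\<^sub>0 nat)" is
  "\<lambda>n L (i, j). if i < n \<and> j < length (L ! i) then L ! i ! j else 0"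
proof -
  fix n and L :: "nat list list"
  have "{x. (case x of (i, j) \<Rightarrow> if i < n \<and> j < length (L ! i) then L ! i ! j else 0) \<noteq> 0}
      \<subseteq> (SIGMA i:{..<n}. {..<length (L ! i)})" by (auto split: if_splits)
  thus "finite {x. (case x of (i, j) \<Rightarrow> if i < n \<and> j < length (L ! i) then L ! i ! j else 0) \<noteq> 0}"
    by (rule finite_subset) auto
qed

lemma is_partition_nth: "L \<in> multi_partitions n \<Longrightarrow> i < n \<Longrightarrow> is_partition (L ! i)"
  by (auto simp: multi_partitions_def)

lemma zero_notin_partition: "L \<in> multi_partitions n \<Longrightarrow> i < n \<Longrightarrow> 0 \<notin> set (L ! i)"
  using is_partition_nth by (auto simp: is_partition_def)

lemma partition_eqI: "is_partition l \<Longrightarrow> is_partition l' \<Longrightarrow> mset l = mset l' \<Longrightarrow> l = l'"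
  by (metis partition_of_mset)

lemma keys_monomial_of: "Poly_Mapping.keys (monomial_of n L) \<subseteq> alphabets n"
  by (auto simp: in_keys_iff monomial_of.rep_eq alphabets_def alphabet_def split: if_splits)

lemma exponents_monomial_of:
  assumes "L \<in> multi_partitions n" "i < n"
  shows "exponents (restrict_monomial (alphabet i) (monomial_of n L)) = mset (L ! i)"
proof -
  let ?l = "L ! i"
  have "?l ! j \<noteq> 0" if "j < length ?l" for j
    using zero_notin_partition[OF assms] that by (metis nth_mem)
  hence keys: "Poly_Mapping.keys (restrict_monomial (alphabet i) (monomial_of n L)) = Pair i ` {..<length ?l}"
    using assms by (auto simp: in_keys_iff monomial_of.rep_eq alphabet_def split: if_splits)
  have "mset_set (Pair i ` {..<length ?l}) = image_mset (Pair i) (mset_set {..<length ?l})"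
    by (intro image_mset_mset_set[symmetric]) (simp add: inj_on_def)
  hence "exponents (restrict_monomial (alphabet i) (monomial_of n L)) =
      image_mset (Poly_Mapping.lookup (restrict_monomial (alphabet i) (monomial_of n L)) \<circ> Pair i) (mset_set {..<length ?l})"
    unfolding exponents_def keys by (simp add: multiset.map_comp)
  also have "\<dots> = image_mset (nth ?l) (mset_set {0..<length ?l})"
    unfolding lessThan_atLeast0 using assms by (intro image_mset_cong)
      (auto simp: restrict_monomial.rep_eq monomial_of.rep_eq alphabet_def)
  also have "\<dots> = mset (map (nth ?l) [0..<length ?l])"
    by (simp only: mset_map mset_upt)
  finally show ?thesis by (simp only: map_nth)
qed

lemma mfps_nth_multi_monomial_of:
  assumes "L \<in> multi_partitions n" "M \<in> multi_partitions n"
  shows "mfps_nth (multi_monomial n M) (monomial_of n L) = (if M = L then 1 else 0)"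
proof -
  have eq: "M = L \<longleftrightarrow> (\<forall>i<n. mset (L ! i) = mset (M ! i))"
  proof
    assume *: "\<forall>i<n. mset (L ! i) = mset (M ! i)"
    have len: "length L = n" "length M = n" using assms by (auto simp: multi_partitions_def)
    show "M = L"
    proof (rule nth_equalityI)
      fix i assume "i < length M"
      thus "M ! i = L ! i"
        using assms * len by (intro partition_eqI is_partition_nth) auto
    qed (simp add: len)
  qed simp
  have "(\<forall>i<n. exponents (restrict_monomial (alphabet i) (monomial_of n L)) = mset (M ! i))
      \<longleftrightarrow> (\<forall>i<n. mset (L ! i) = mset (M ! i))"
    using exponents_monomial_of[OF assms(1)] by auto
  thus ?thesis
    unfolding mfps_nth_multi_monomial by (simp only: keys_monomial_of eq simp_thms)
qed

text \<open>The coefficients at the representatives are the coordinates of f. To confine f to the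
  span of certain monomial functions it thus suffices to know where these coefficients are
  nonzero.\<close>

lemma multi_monomial_expansion:
  assumes "f \<in> multi_sym_space n"
  shows "f \<in> mfps.span (multi_monomial n ` {L \<in> multi_partitions n. mfps_nth f (monomial_of n L) \<noteq> 0})"
proof -
  have "\<exists>S. finite S \<and> S \<subseteq> multi_partitions n \<and>
      f = (\<Sum>L\<in>S. mfps_scale (mfps_nth f (monomial_of n L)) (multi_monomial n L))"
    using assms unfolding multi_sym_space_def
  proof (induction rule: mfps.span_induct_alt)
    case base
    show ?case by (rule exI[of _ "{}"]) simp
  next
    case (step c x y)
    then obtain M S where M: "M \<in> multi_partitions n" "x = multi_monomial n M"
      and S: "finite S" "S \<subseteq> multi_partitions n"
        "y = (\<Sum>L\<in>S. mfps_scale (mfps_nth y (monomial_of n L)) (multi_monomial n L))"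
      by auto
    let ?S = "insert M S"
    have outside: "mfps_nth y (monomial_of n M) = 0" if "M \<notin> S"
      using that S(1,2) M by (subst S(3)) (auto simp: mfps_nth_sum mfps_nth_multi_monomial_of intro!: sum.neutral)
    have "y = (\<Sum>L\<in>?S. mfps_scale (mfps_nth y (monomial_of n L)) (multi_monomial n L))"
      by (subst S(3), rule sum.mono_neutral_left) (use S(1) outside in auto)
    moreover have "mfps_scale c x = (\<Sum>L\<in>?S. mfps_scale (if M = L then c else 0) (multi_monomial n L))"
      using S(1) by (simp add: M(2) if_distrib[of "\<lambda>c. mfps_scale c _"] cong: if_cong)
    ultimately have "mfps_scale c x + y =
        (\<Sum>L\<in>?S. mfps_scale ((if M = L then c else 0) + mfps_nth y (monomial_of n L)) (multi_monomial n L))"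
      by (simp only: mfps.scale_left_distrib sum.distrib)
    also have "\<dots> = (\<Sum>L\<in>?S. mfps_scale (mfps_nth (mfps_scale c x + y) (monomial_of n L)) (multi_monomial n L))"
      using S(2) M by (intro sum.cong refl)
        (auto simp: plus_mfps.rep_eq mfps_nth_multi_monomial_of)
    finally show ?case using S M by (intro exI[of _ ?S]) auto
  qed
  then obtain S where S: "finite S" "S \<subseteq> multi_partitions n"
    "f = (\<Sum>L\<in>S. mfps_scale (mfps_nth f (monomial_of n L)) (multi_monomial n L))" by blast
  show ?thesis
  proof (subst S(3), rule mfps.span_sum)
    fix L assume "L \<in> S"
    hence L: "L \<in> multi_partitions n" using S(2) by blast
    show "mfps_scale (mfps_nth f (monomial_of n L)) (multi_monomial n L) \<in>
        mfps.span (multi_monomial n ` {L \<in> multi_partitions n. mfps_nth f (monomial_of n L) \<noteq> 0})"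
    proof (cases "mfps_nth f (monomial_of n L) = 0")
      case True
      thus ?thesis by (simp only: mfps.scale_zero_left mfps.span_zero)
    next
      case False
      thus ?thesis using L by (intro mfps.span_scale mfps.span_base imageI) simp
    qed
  qed
qed

lemma inj_on_multi_monomial: "inj_on (multi_monomial n) (multi_partitions n)"
proof (rule inj_onI)
  fix L M assume L: "L \<in> multi_partitions n" and M: "M \<in> multi_partitions n"
    and eq: "multi_monomial n L = multi_monomial n M"
  have "(if M = L then 1 else 0) = (1 :: qt)"
    using mfps_nth_multi_monomial_of[OF L M] mfps_nth_multi_monomial_of[OF L L] by (simp only: eq simp_thms if_True)
  thus "L = M" by (cases "M = L") simp_all
qed

lemma independent_multi_monomial: "mfps.independent (multi_monomial n ` multi_partitions n)"
proof
  assume "mfps.dependent (multi_monomial n ` multi_partitions n)"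
  then obtain L where L: "L \<in> multi_partitions n"
    "multi_monomial n L \<in> mfps.span (multi_monomial n ` multi_partitions n - {multi_monomial n L})"
    by (auto simp: mfps.dependent_def)
  \<comment> \<open>The coordinate functional of L vanishes on all other monomial functions but
    takes the value 1 on its own.\<close>
  let ?Z = "{f. mfps_nth f (monomial_of n L) = 0}"
  have "mfps.span (multi_monomial n ` multi_partitions n - {multi_monomial n L}) \<subseteq> ?Z"
    using L(1) by (intro mfps.span_minimal mfps.subspaceI)
      (auto simp: zero_mfps.rep_eq plus_mfps.rep_eq mfps_nth_multi_monomial_of)
  thus False using L by (auto simp: mfps_nth_multi_monomial_of)
qed

text \<open>The product formula changes component i only, and each shape it produces is again a
  partition.\<close>

lemma power_sum_mult_multi_sym_space:
  assumes "f \<in> multi_sym_space n" "i < n" "r > 0"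
  shows "power_sum (alphabet i) r * f \<in> multi_sym_space n"
  using assms(1) unfolding multi_sym_space_def
proof (induction rule: mfps.span_induct_alt)
  case base
  show ?case by (simp add: mfps.span_zero)
next
  case (step c x y)
  then obtain L where L: "L \<in> multi_partitions n" "x = multi_monomial n L" by auto
  define S where "S = insert (add_mset r (mset (L ! i))) (pieri_shapes r (mset (L ! i)))"
  let ?a = "\<lambda>T. of_nat (pieri_coeff r (mset (L ! i)) T)"
  have "multi_monomial n L = monomial_sym (alphabet i) (L ! i) *
     (\<Prod>j\<in>{..<n} - {i}. monomial_sym (alphabet j) (L ! j))"
    unfolding multi_monomial_def using assms(2) by (intro prod.remove) auto
  hence "power_sum (alphabet i) r * x =
     (power_sum (alphabet i) r * monomial_sym (alphabet i) (L ! i)) *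
     (\<Prod>j\<in>{..<n} - {i}. monomial_sym (alphabet j) (L ! j))"
    by (simp add: L mult.assoc)
  also have "\<dots> = (\<Sum>T\<in>S. mfps_scale (?a T) (monomial_sym (alphabet i) (partition_of T)
     * (\<Prod>j\<in>{..<n} - {i}. monomial_sym (alphabet j) (L ! j))))"
    by (simp only: power_sum_mult_monomial_sym[OF assms(3)] S_def[symmetric] sum_distrib_right mfps_scale_mult_left)
  also have "\<dots> = (\<Sum>T\<in>S. mfps_scale (?a T) (multi_monomial n (L[i := partition_of T])))"
  proof (intro sum.cong refl arg_cong2[of _ _ _ _ mfps_scale])
    fix T
    have len: "length L = n" using L by (simp add: multi_partitions_def)
    have "multi_monomial n (L[i := partition_of T]) = monomial_sym (alphabet i) (L[i := partition_of T] ! i) *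
       (\<Prod>j\<in>{..<n} - {i}. monomial_sym (alphabet j) (L[i := partition_of T] ! j))"
      unfolding multi_monomial_def using assms(2) by (intro prod.remove) auto
    also have "(\<Prod>j\<in>{..<n} - {i}. monomial_sym (alphabet j) (L[i := partition_of T] ! j) :: msf) =
       (\<Prod>j\<in>{..<n} - {i}. monomial_sym (alphabet j) (L ! j))"
      by (intro prod.cong) auto
    finally show "monomial_sym (alphabet i) (partition_of T)
     * (\<Prod>j\<in>{..<n} - {i}. monomial_sym (alphabet j) (L ! j)) = multi_monomial n (L[i := partition_of T])"
      using len assms(2) by simp
  qed
  also have "\<dots> \<in> mfps.span (multi_monomial n ` multi_partitions n)"
  proof (intro mfps.span_sum mfps.span_scale mfps.span_base imageI)
    fix T assume "T \<in> S"
    moreover have "0 \<notin># N" if "N = mset (L ! i)" for N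
      using zero_notin_partition[OF L(1) assms(2)] that by simp
    ultimately have "0 \<notin># T"
      using assms(3) unfolding S_def by (auto simp only: pieri_shapes_def) (auto dest: in_diffD)
    hence "is_partition (partition_of T)" by (rule is_partition_partition_of)
    thus "L[i := partition_of T] \<in> multi_partitions n"
      using L(1) set_update_subset_insert[of L i "partition_of T"]
      by (auto simp: multi_partitions_def)
  qed
  finally have "mfps_scale c (power_sum (alphabet i) r * x) + power_sum (alphabet i) r * y
      \<in> mfps.span (multi_monomial n ` multi_partitions n)"
    using step(2) by (intro mfps.span_add mfps.span_scale)
  thus ?case by (simp add: distrib_left)
qed

section \<open>The basis of power sums\<close>

definition generator :: "nat \<times> nat \<Rightarrow> msf" where
  "generator = (\<lambda>(k, r). power_sum (\<Union>i\<le>k. alphabet i) r)"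

definition generators :: "nat \<Rightarrow> (nat \<times> nat) set" where
  "generators n = {..<n} \<times> {0<..}"

definition power_monomial :: "(nat \<times> nat) multiset \<Rightarrow> msf" where
  "power_monomial K = (\<Prod>x\<in>#K. generator x)"

definition power_shapes :: "nat \<Rightarrow> (nat \<times> nat) multiset set" where
  "power_shapes n = {K. set_mset K \<subseteq> generators n}"

definition weight :: "(nat \<times> nat) multiset \<Rightarrow> nat" where
  "weight K = (\<Sum>x\<in>#K. snd x)"

text \<open>As a multiset of pairs (component, part), a multi-partition is an exponent vector in the
  generators: multiplication by a generator becomes \<open>add_mset\<close>, and differentiation
  becomes removal.\<close>

definition shape :: "nat \<Rightarrow> nat list list \<Rightarrow> (nat \<times> nat) multiset" where
  "shape n L = (\<Sum>k<n. image_mset (Pair k) (mset (L ! k)))"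

lemma power_monomial_empty [simp]: "power_monomial {#} = 1"
  by (simp add: power_monomial_def)

lemma power_monomial_add_mset [simp]:
  "power_monomial (add_mset x K) = generator x * power_monomial K"
  by (simp add: power_monomial_def)

lemma empty_power_shapes [simp]: "{#} \<in> power_shapes n"
  by (simp add: power_shapes_def)

lemma add_mset_power_shapes [simp]:
  "add_mset x K \<in> power_shapes n \<longleftrightarrow> x \<in> generators n \<and> K \<in> power_shapes n"
  by (simp add: power_shapes_def)

lemma multi_power_sum_eq: "multi_power_sum n L = power_monomial (shape n L)"
proof -
  have "power_monomial (\<Sum>k<n. image_mset (Pair k) (mset (L ! k))) =
      (\<Prod>k<n. power_monomial (image_mset (Pair k) (mset (L ! k))))"
    by (induction n) (simp_all add: power_monomial_def)
  also have "\<dots> = multi_power_sum n L"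
    unfolding multi_power_sum_def power_sum_sym_def power_monomial_def generator_def
    by (intro prod.cong refl) (simp add: image_mset.compositionality comp_def prod_mset_prod_list[symmetric])
  finally show ?thesis by (simp add: shape_def)
qed

lemma count_sum_mset: "count (\<Sum>x\<in>A. f x) a = (\<Sum>x\<in>A. count (f x) a)"
  by (induction A rule: infinite_finite_induct) auto

lemma count_image_mset_Pair: "count (image_mset (Pair i) M) (k, r) = (if i = k then count M r else 0)"
  by (induction M) auto

lemma count_shape: "k < n \<Longrightarrow> count (shape n L) (k, r) = count (mset (L ! k)) r"
proof -
  assume k: "k < n"
  thus ?thesis using k by (simp add: shape_def count_sum_mset count_image_mset_Pair)
qed

lemma set_mset_shape: "set_mset (shape n L) = (SIGMA k:{..<n}. set (L ! k))"
  unfolding shape_def by (subst set_mset_sum) auto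

lemma weight_shape: "weight (shape n L) = bar_size n L"
proof -
  have "weight (\<Sum>k<n. image_mset (Pair k) (mset (L ! k))) = (\<Sum>k<n. sum_list (L ! k))"
    by (induction n) (simp_all add: weight_def image_mset.compositionality comp_def sum_mset_sum_list)
  thus ?thesis by (simp add: shape_def bar_size_def)
qed

lemma shape_in_power_shapes: "L \<in> multi_partitions n \<Longrightarrow> shape n L \<in> power_shapes n"
  using zero_notin_partition[of L n]
  by (auto simp: power_shapes_def generators_def set_mset_shape intro: gr0I)

lemma inj_on_shape: "inj_on (shape n) (multi_partitions n)"
proof (rule inj_onI)
  fix L M assume LM: "L \<in> multi_partitions n" "M \<in> multi_partitions n" "shape n L = shape n M"
  have len: "length L = n" "length M = n" using LM by (auto simp: multi_partitions_def)
  show "L = M"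
  proof (rule nth_equalityI)
    fix i assume "i < length L"
    hence i: "i < n" using len by simp
    have "mset (L ! i) = mset (M ! i)"
      using count_shape[OF i, of L] count_shape[OF i, of M] LM(3) by (intro multiset_eqI) simp
    thus "L ! i = M ! i"
      using LM i by (intro partition_eqI is_partition_nth) auto
  qed (simp add: len)
qed

lemma shape_surj:
  assumes "K \<in> power_shapes n"
  shows "\<exists>L\<in>multi_partitions n. shape n L = K"
proof
  define L where "L = map (\<lambda>k. partition_of (image_mset snd (filter_mset (\<lambda>x. fst x = k) K))) [0..<n]"
  have K: "r > 0" "k < n" if "(k, r) \<in># K" for k r
    using assms that by (auto simp: power_shapes_def generators_def)
  show "L \<in> multi_partitions n"
    using K by (auto simp: multi_partitions_def L_def intro!: is_partition_partition_of) fastforce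
  show "shape n L = K"
  proof (rule multiset_eqI)
    fix x :: "nat \<times> nat"
    obtain k r where x: "x = (k, r)" by (cases x)
    show "count (shape n L) x = count K x"
    proof (cases "k < n")
      case True
      have "count (image_mset snd (filter_mset (\<lambda>x. fst x = k) K)) r = count K (k, r)"
        by (induction K) auto
      thus ?thesis using True by (simp add: x count_shape L_def)
    next
      case False
      hence "x \<notin># shape n L" "x \<notin># K" using K by (auto simp: set_mset_shape x)
      thus ?thesis by (simp add: not_in_iff)
    qed
  qed
qed

lemma shape_image: "shape n ` multi_partitions n = power_shapes n"
  using shape_in_power_shapes shape_surj by blast

text \<open>For r > 0 the power v^r determines v, and v lies in exactly one alphabet. For r = 0 the
  union would count the constant monomial once, but the sum would count it k + 1 times.\<close>

lemma generator_conv: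
  assumes "r > 0"
  shows "generator (k, r) = (\<Sum>i\<le>k. power_sum (alphabet i) r)"
proof (rule mfps_eqI)
  fix m
  show "mfps_nth (generator (k, r)) m = mfps_nth (\<Sum>i\<le>k. power_sum (alphabet i) r) m"
  proof (cases "\<exists>v. m = Poly_Mapping.single v r")
    case True
    then obtain i j where m: "m = Poly_Mapping.single (i, j) r" by auto
    have eq: "Poly_Mapping.single (i, j) r = Poly_Mapping.single v r \<longleftrightarrow> v = (i, j)" for v
      using assms by (auto dest: arg_cong[where f = Poly_Mapping.keys])
    show ?thesis
      by (simp add: generator_def mfps_nth_power_sum mfps_nth_sum m eq alphabet_def Bex_def
          flip: all_simps ex_simps)
  next
    case False
    thus ?thesis by (auto simp: generator_def mfps_nth_power_sum mfps_nth_sum)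
  qed
qed

lemma power_sum_alphabet_conv:
  assumes "r > 0"
  shows "power_sum (alphabet i) r = generator (i, r) - (if i = 0 then 0 else generator (i - 1, r))"
  using assms by (cases i) (simp_all add: generator_conv)

text \<open>The grading by degree cuts the power sums into finite pieces, which makes a counting
  argument for their independence possible.\<close>

definition power_space :: "nat \<Rightarrow> nat \<Rightarrow> msf set" where
  "power_space n d = mfps.span (power_monomial ` {K \<in> power_shapes n. weight K = d})"

lemma generator_mult_power_space:
  assumes "f \<in> power_space n d" "(k, r) \<in> generators n"
  shows "generator (k, r) * f \<in> power_space n (d + r)"
  using assms(1) unfolding power_space_def
proof (induction rule: mfps.span_induct_alt)
  case base
  show ?case by (simp add: mfps.span_zero)
next
  case (step c x y)
  then obtain K where K: "K \<in> power_shapes n" "weight K = d" "x = power_monomial K" by auto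
  have "generator (k, r) * x \<in> mfps.span (power_monomial ` {K \<in> power_shapes n. weight K = d + r})"
    by (rule mfps.span_base, rule image_eqI[of _ _ "add_mset (k, r) K"])
       (use K assms(2) in \<open>auto simp: weight_def\<close>)
  hence "mfps_scale c (generator (k, r) * x) + generator (k, r) * y
      \<in> mfps.span (power_monomial ` {K \<in> power_shapes n. weight K = d + r})"
    using step(2) by (intro mfps.span_add mfps.span_scale)
  thus ?case by (simp add: distrib_left)
qed

lemma power_sum_mult_power_space:
  assumes "f \<in> power_space n d" "i < n" "r > 0"
  shows "power_sum (alphabet i) r * f \<in> power_space n (d + r)"
proof -
  have "generator (i, r) * f \<in> power_space n (d + r)"
    using assms by (intro generator_mult_power_space) (auto simp: generators_def)
  moreover have "(if i = 0 then 0 else generator (i - 1, r)) * f \<in> power_space n (d + r)"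
    using generator_mult_power_space[OF assms(1), of "i - 1" r] assms
    by (auto simp: generators_def power_space_def mfps.span_zero)
  ultimately show ?thesis
    unfolding power_sum_alphabet_conv[OF assms(3)] left_diff_distrib power_space_def
    by (intro mfps.span_diff)
qed

lemma multi_monomial_in_power_space:
  assumes "L \<in> multi_partitions n"
  shows "multi_monomial n L \<in> power_space n (bar_size n L)"
proof -
  have "(\<Prod>i<k. monomial_sym (alphabet i) (L ! i)) \<in> power_space n (\<Sum>i<k. sum_list (L ! i))" if "k \<le> n" for k
    using that
  proof (induction k)
    case 0
    have "1 \<in> power_monomial ` {K \<in> power_shapes n. weight K = 0}"
      by (rule image_eqI[of _ _ "{#}"]) (auto simp: weight_def)
    thus ?case by (simp add: power_space_def mfps.span_base)
  next
    case (Suc k)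
    let ?s = "\<Sum>i<k. sum_list (L ! i)"
    have "monomial_sym (alphabet k) (L ! k) * (\<Prod>i<k. monomial_sym (alphabet i) (L ! i)) \<in> power_space n (?s + sum_list (L ! k))"
    \<comment> \<open>The fixed factor is the product over the earlier alphabets, whose degree
      shifts the index by \<open>?s\<close>.\<close>
    proof (rule monomial_sym_induct[where \<Phi> = "\<lambda>d f. f \<in> power_space n (?s + d)"])
      show "(\<Prod>i<k. monomial_sym (alphabet i) (L ! i)) \<in> power_space n (?s + 0)" using Suc by simp
      show "power_sum (alphabet k) r * f \<in> power_space n (?s + (d + r))"
        if "r > 0" "f \<in> power_space n (?s + d)" for d r f
        using power_sum_mult_power_space[OF that(2) _ that(1), of k] Suc.prems by (simp add: add.assoc)
      show "0 \<notin> set (L ! k)" using zero_notin_partition[OF assms] Suc.prems by simp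
    qed (auto simp only: power_space_def intro: mfps.span_diff mfps.span_scale)
    thus ?case by (simp add: mult.commute)
  qed
  from this[of n] show ?thesis by (simp add: multi_monomial_def bar_size_def)
qed

section \<open>Independence of the power sums by counting\<close>

lemma finite_bounded_multi_partitions: "finite {L \<in> multi_partitions n. bar_size n L \<le> d}"
proof (rule finite_subset)
  let ?P = "{l. set l \<subseteq> {..d} \<and> length l \<le> d}"
  show "finite {L. set L \<subseteq> ?P \<and> length L = n}"
    by (intro finite_lists_length_eq finite_lists_length_le) auto
  show "{L \<in> multi_partitions n. bar_size n L \<le> d} \<subseteq> {L. set L \<subseteq> ?P \<and> length L = n}"
  proof (rule subsetI, rule CollectI, intro conjI subsetI)
    fix L assume L: "L \<in> {L \<in> multi_partitions n. bar_size n L \<le> d}"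
    thus len: "length L = n" by (simp add: multi_partitions_def)
    fix l assume "l \<in> set L"
    then obtain i where i: "i < n" "l = L ! i" using len by (auto simp: in_set_conv_nth)
    have "sum_list l \<le> bar_size n L"
      unfolding bar_size_def i(2) using i(1) by (intro member_le_sum) auto
    hence sum: "sum_list l \<le> d" using L by simp
    have "0 \<notin> set l" using zero_notin_partition L i by auto
    hence "length l \<le> sum_list l" by (induction l) auto
    moreover have "x \<le> sum_list l" if "x \<in> set l" for x using that by (intro member_le_sum_list) auto
    ultimately show "l \<in> ?P" using sum by (auto intro: order_trans)
  qed
qed

text \<open>The \<open>card T\<close> independent monomial functions lie in the span of the power
  sums indexed by T. Hence these power sums are pairwise distinct and admit no linear
  relation.\<close>

lemma power_basis_bounded:
  fixes n d :: nat
  defines "T \<equiv> {L \<in> multi_partitions n. bar_size n L \<le> d}"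
  shows "inj_on (multi_power_sum n) T" "mfps.independent (multi_power_sum n ` T)"
proof -
  have fin: "finite T" unfolding T_def by (rule finite_bounded_multi_partitions)
  have "multi_monomial n ` T \<subseteq> mfps.span (multi_power_sum n ` T)"
  proof
    fix f assume "f \<in> multi_monomial n ` T"
    then obtain L where L: "L \<in> multi_partitions n" "bar_size n L \<le> d" "f = multi_monomial n L"
      by (auto simp: T_def)
    have "power_monomial ` {K \<in> power_shapes n. weight K = bar_size n L} \<subseteq> multi_power_sum n ` T"
    proof
      fix g assume "g \<in> power_monomial ` {K \<in> power_shapes n. weight K = bar_size n L}"
      then obtain K where K: "K \<in> power_shapes n" "weight K = bar_size n L" "g = power_monomial K" by auto
      then obtain M where "M \<in> multi_partitions n" "shape n M = K" using shape_surj by blast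
      thus "g \<in> multi_power_sum n ` T"
        using K L(2) by (auto simp: T_def multi_power_sum_eq weight_shape)
    qed
    hence "power_space n (bar_size n L) \<subseteq> mfps.span (multi_power_sum n ` T)"
      unfolding power_space_def by (rule mfps.span_mono)
    thus "f \<in> mfps.span (multi_power_sum n ` T)"
      using multi_monomial_in_power_space[OF L(1)] L(3) by auto
  qed
  moreover have "mfps.independent (multi_monomial n ` T)"
    by (rule mfps.independent_mono[OF independent_multi_monomial]) (auto simp: T_def)
  \<comment> \<open>The exchange lemma bounds the size of every finite spanning set from
    below.\<close>
  ultimately have bound: "card T \<le> card S" if "finite S" "mfps.span S = mfps.span (multi_power_sum n ` T)" for S
  proof -
    assume *: "multi_monomial n ` T \<subseteq> mfps.span (multi_power_sum n ` T)" "mfps.independent (multi_monomial n ` T)"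
    have "card (multi_monomial n ` T) = card T"
      by (rule card_image) (rule inj_on_subset[OF inj_on_multi_monomial], auto simp: T_def)
    thus ?thesis using mfps.independent_span_bound[OF that(1) *(2)] *(1) that(2) by simp
  qed
  show "inj_on (multi_power_sum n) T"
    using bound[of "multi_power_sum n ` T"] fin by (intro eq_card_imp_inj_on antisym card_image_le) auto
  show "mfps.independent (multi_power_sum n ` T)"
  proof
    assume "mfps.dependent (multi_power_sum n ` T)"
    then obtain a where a: "a \<in> multi_power_sum n ` T" "a \<in> mfps.span (multi_power_sum n ` T - {a})"
      by (auto simp: mfps.dependent_def)
    \<comment> \<open>A dependent element could be dropped, leaving a spanning set that is too
      small.\<close>
    have "mfps.span (multi_power_sum n ` T - {a}) = mfps.span (multi_power_sum n ` T)"
      using mfps.span_redundant[OF a(2)] a(1) by (simp add: insert_absorb)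
    hence "card T \<le> card (multi_power_sum n ` T - {a})" using fin by (intro bound) auto
    also have "\<dots> < card (multi_power_sum n ` T)"
      using a(1) fin by (intro psubset_card_mono) auto
    also have "\<dots> \<le> card T" using fin by (rule card_image_le)
    finally show False by simp
  qed
qed

lemma inj_on_multi_power_sum: "inj_on (multi_power_sum n) (multi_partitions n)"
proof (rule inj_onI)
  fix L M assume "L \<in> multi_partitions n" "M \<in> multi_partitions n" "multi_power_sum n L = multi_power_sum n M"
  thus "L = M"
    using inj_onD[OF power_basis_bounded(1)[of n "max (bar_size n L) (bar_size n M)"], of L M] by simp
qed

lemma independent_multi_power_sum: "mfps.independent (multi_power_sum n ` multi_partitions n)"
  unfolding mfps.independent_explicit_finite_subsets
proof (intro allI impI)
  fix S u assume S: "S \<subseteq> multi_power_sum n ` multi_partitions n" "finite S" "(\<Sum>v\<in>S. mfps_scale (u v) v) = 0"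
  obtain T where T: "T \<subseteq> multi_partitions n" "finite T" "S = multi_power_sum n ` T"
    using finite_subset_image[OF S(2,1)] by blast
  \<comment> \<open>The sum of the finitely many degrees serves as a common degree bound.\<close>
  have "bar_size n L \<le> (\<Sum>L\<in>T. bar_size n L)" if "L \<in> T" for L
    using T(2) that by (intro member_le_sum) auto
  hence "S \<subseteq> multi_power_sum n ` {L \<in> multi_partitions n. bar_size n L \<le> (\<Sum>L\<in>T. bar_size n L)}"
    using T by auto
  hence "mfps.independent S" using power_basis_bounded(2) mfps.independent_mono by blast
  thus "\<forall>v\<in>S. u v = 0"
    using S(2,3) mfps.independentD[of S S u] by auto
qed

lemma power_monomial_image: "power_monomial ` power_shapes n = multi_power_sum n ` multi_partitions n"
  by (simp add: shape_image[symmetric] image_image multi_power_sum_eq)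

lemma multi_sym_space_power: "multi_sym_space n = mfps.span (power_monomial ` power_shapes n)"
proof
  have "multi_monomial n L \<in> mfps.span (power_monomial ` power_shapes n)" if "L \<in> multi_partitions n" for L
    using multi_monomial_in_power_space[OF that]
      mfps.span_mono[of "power_monomial ` {K \<in> power_shapes n. weight K = bar_size n L}" "power_monomial ` power_shapes n"]
    unfolding power_space_def by auto
  thus "multi_sym_space n \<subseteq> mfps.span (power_monomial ` power_shapes n)"
    unfolding multi_sym_space_def by (intro mfps.span_minimal) auto
  \<comment> \<open>For the converse inclusion, each generator is a sum of power sums of single
    alphabets, and multiplication by those preserves the space.\<close>
  have "power_monomial K \<in> multi_sym_space n" if "K \<in> power_shapes n" for K
    using that
  proof (induction K)
    case empty
    have "1 = multi_monomial n (replicate n [])" by (simp add: multi_monomial_def)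
    moreover have "replicate n [] \<in> multi_partitions n" by (auto simp: multi_partitions_def is_partition_def)
    ultimately have "1 \<in> multi_sym_space n"
      unfolding multi_sym_space_def by (metis image_eqI mfps.span_base)
    thus ?case by simp
  next
    case (add x K)
    obtain k r where x: "x = (k, r)" by (cases x)
    have "power_sum (alphabet i) r * power_monomial K \<in> multi_sym_space n" if "i \<le> k" for i
      using add that by (intro power_sum_mult_multi_sym_space) (auto simp: x generators_def)
    thus ?case
      using add.prems
      by (auto simp: x generators_def generator_conv sum_distrib_right multi_sym_space_def intro!: mfps.span_sum)
  qed
  thus "mfps.span (power_monomial ` power_shapes n) \<subseteq> multi_sym_space n"
    by (intro mfps.span_minimal) (auto simp: multi_sym_space_def)
qed

section \<open>Closure properties and induction principles for multi-symmetric functions\<close>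

lemma multi_sym_space_zero: "0 \<in> multi_sym_space n"
  and multi_sym_space_add: "f \<in> multi_sym_space n \<Longrightarrow> g \<in> multi_sym_space n \<Longrightarrow> f + g \<in> multi_sym_space n"
  and multi_sym_space_diff: "f \<in> multi_sym_space n \<Longrightarrow> g \<in> multi_sym_space n \<Longrightarrow> f - g \<in> multi_sym_space n"
  and multi_sym_space_scale: "f \<in> multi_sym_space n \<Longrightarrow> mfps_scale c f \<in> multi_sym_space n"
  unfolding multi_sym_space_def
  by (intro mfps.span_zero mfps.span_add mfps.span_diff mfps.span_scale; assumption)+

lemma power_monomial_in_space: "K \<in> power_shapes n \<Longrightarrow> power_monomial K \<in> multi_sym_space n"
  by (simp add: multi_sym_space_power mfps.span_base)

lemma one_in_multi_sym_space: "1 \<in> multi_sym_space n"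
  using power_monomial_in_space[of "{#}" n] by simp

lemma multi_sym_space_power_induct [consumes 1, case_names zero step]:
  assumes "f \<in> multi_sym_space n" "P 0"
    and "\<And>c K f. K \<in> power_shapes n \<Longrightarrow> f \<in> multi_sym_space n \<Longrightarrow> P f
      \<Longrightarrow> P (mfps_scale c (power_monomial K) + f)"
  shows "P f"
proof -
  from assms(1) have "f \<in> multi_sym_space n \<and> P f"
    unfolding multi_sym_space_power
  proof (induction rule: mfps.span_induct_alt)
    case (step c x y)
    then obtain K where "K \<in> power_shapes n" "x = power_monomial K" by auto
    thus ?case
      using step assms(3)
      by (auto simp: multi_sym_space_power intro!: mfps.span_add mfps.span_scale[OF mfps.span_base])
  qed (use assms(2) in \<open>auto simp: mfps.span_zero\<close>)
  thus ?thesis by simp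
qed

lemma generator_mult_in_space:
  assumes "f \<in> multi_sym_space n" "x \<in> generators n"
  shows "generator x * f \<in> multi_sym_space n"
  using assms(1)
proof (induction rule: multi_sym_space_power_induct)
  case zero
  show ?case by (simp add: multi_sym_space_zero)
next
  case (step c K f)
  have "power_monomial (add_mset x K) \<in> multi_sym_space n"
    using step assms(2) by (intro power_monomial_in_space) simp
  hence "mfps_scale c (generator x * power_monomial K) + generator x * f \<in> multi_sym_space n"
    using step by (intro multi_sym_space_add multi_sym_space_scale) simp_all
  thus ?case by (simp add: distrib_left)
qed

text \<open>This induction runs over power sums of single alphabets, on which sigma acts by scalars;
  a generator in general mixes several of its eigenvalues.\<close>

lemma multi_sym_space_induct [consumes 1, case_names one mult add scale]:
  assumes f: "f \<in> multi_sym_space n"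
    and one: "P 1"
    and mult: "\<And>i r f. i < n \<Longrightarrow> r > 0 \<Longrightarrow> f \<in> multi_sym_space n \<Longrightarrow> P f \<Longrightarrow> P (power_sum (alphabet i) r * f)"
    and add: "\<And>f g. f \<in> multi_sym_space n \<Longrightarrow> g \<in> multi_sym_space n \<Longrightarrow> P f \<Longrightarrow> P g \<Longrightarrow> P (f + g)"
    and scale: "\<And>c f. f \<in> multi_sym_space n \<Longrightarrow> P f \<Longrightarrow> P (mfps_scale c f)"
  shows "P f"
  using f
proof (induction rule: multi_sym_space_power_induct)
  case zero
  show ?case using scale[OF one_in_multi_sym_space one, of 0] by simp
next
  case (step c K f)
  have sum: "P (sum h S) \<and> sum h S \<in> multi_sym_space n"
    if "finite S" "S \<noteq> {}" "\<And>i. i \<in> S \<Longrightarrow> P (h i) \<and> h i \<in> multi_sym_space n" for h :: "nat \<Rightarrow> msf" and S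
    using that by (induction rule: finite_ne_induct) (auto intro: add multi_sym_space_add)
  have "P (power_monomial K)"
    using step(1)
  proof (induction K)
    case empty
    thus ?case using one by simp
  next
    case (add x K)
    obtain k r where x: "x = (k, r)" by (cases x)
    have kr: "k < n" "r > 0" "K \<in> power_shapes n" using add.prems by (auto simp: x generators_def)
    have "P (\<Sum>i\<le>k. power_sum (alphabet i) r * power_monomial K)"
    proof (intro conjunct1[OF sum] conjI)
      fix i assume "i \<in> {..k}"
      thus "P (power_sum (alphabet i) r * power_monomial K)"
        and "power_sum (alphabet i) r * power_monomial K \<in> multi_sym_space n"
        using kr add.IH by (auto intro!: mult power_sum_mult_multi_sym_space power_monomial_in_space)
    qed auto
    thus ?case using kr by (simp add: x generator_conv sum_distrib_right)
  qed
  thus ?case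
    using step by (intro add scale multi_sym_space_scale power_monomial_in_space) auto
qed

section \<open>The scalar product\<close>

text \<open>The exponent of q in \<open>power_sum_norm\<close> is the sum of (n-1-k)r over all parts
  r of all components k, so the norm factors over the parts. The factor r is the contribution of a
  part to z, apart from the factorials of multiplicities.\<close>

definition generator_norm :: "nat \<Rightarrow> nat \<times> nat \<Rightarrow> qt" where
  "generator_norm n = (\<lambda>(k, r). of_nat r * qq powi ((int n - 1 - int k) * int r)
     * (if k = n - 1 then (1 - qq ^ r) / (1 - tt ^ r) else 1))"

definition shape_norm :: "nat \<Rightarrow> (nat \<times> nat) multiset \<Rightarrow> qt" where
  "shape_norm n K = (\<Prod>x\<in>#K. generator_norm n x) * of_nat (\<Prod>x\<in>set_mset K. fact (count K x))"

lemma qq_nonzero [simp]: "qq \<noteq> 0" and tt_nonzero [simp]: "tt \<noteq> 0"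
  by (simp_all add: qq_def tt_def)

lemma to_fract_power: "to_fract x ^ k = to_fract (x ^ k)"
  by (induction k) simp_all

lemma qq_power_neq_1: "r > 0 \<Longrightarrow> qq ^ r \<noteq> 1"
  and tt_power_neq_1: "r > 0 \<Longrightarrow> tt ^ r \<noteq> 1"
proof -
  have 1: "(1 :: qt) = to_fract 1" by simp
  assume r: "r > 0"
  show "qq ^ r \<noteq> 1"
  proof
    assume "qq ^ r = 1"
    hence "[:[:0, 1 :: rat:]:] ^ r = 1" unfolding qq_def to_fract_power 1 to_fract_eq_iff .
    from arg_cong[OF this, of "\<lambda>p. poly (poly p 0) 0"] show False using r by (simp add: poly_power zero_power)
  qed
  show "tt ^ r \<noteq> 1"
  proof
    assume "tt ^ r = 1"
    hence "[:0, 1 :: rat poly:] ^ r = 1" unfolding tt_def to_fract_power 1 to_fract_eq_iff .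
    from arg_cong[OF this, of "\<lambda>p. poly p 0"] show False using r by (simp add: poly_power zero_power)
  qed
qed

lemma shape_norm_nonzero:
  assumes "K \<in> power_shapes n"
  shows "shape_norm n K \<noteq> 0"
proof -
  have "generator_norm n x \<noteq> 0" if "x \<in> generators n" for x
    using that qq_power_neq_1 tt_power_neq_1
    by (auto simp: generator_norm_def generators_def split: if_splits)
  moreover have "(\<Prod>x\<in>set_mset K. fact (count K x)) \<noteq> (0 :: nat)" by simp
  ultimately show ?thesis
    using assms by (auto simp: shape_norm_def prod_mset_zero_iff power_shapes_def)
qed

lemma shape_norm_empty [simp]: "shape_norm n {#} = 1"
  by (simp add: shape_norm_def)

text \<open>The factor \<open>Suc (count K x)\<close> is the one that differentiation of a power
  produces; this agreement makes a derivation the adjoint of multiplication by a generator.\<close>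

lemma shape_norm_add_mset:
  "shape_norm n (add_mset x K) = generator_norm n x * of_nat (Suc (count K x)) * shape_norm n K"
proof -
  let ?S = "insert x (set_mset K)"
  have "(\<Prod>y\<in>?S. fact (count (add_mset x K) y)) =
      fact (Suc (count K x)) * (\<Prod>y\<in>?S - {x}. fact (count (add_mset x K) y))"
    by (subst prod.remove[of _ x]) auto
  also have "(\<Prod>y\<in>?S - {x}. fact (count (add_mset x K) y)) = (\<Prod>y\<in>?S - {x}. fact (count K y))"
    by (intro prod.cong) auto
  also have "fact (Suc (count K x)) * (\<Prod>y\<in>?S - {x}. fact (count K y)) =
      Suc (count K x) * (fact (count K x) * (\<Prod>y\<in>?S - {x}. fact (count K y)))"
    by (simp add: algebra_simps)
  also have "fact (count K x) * (\<Prod>y\<in>?S - {x}. fact (count K y)) = (\<Prod>y\<in>?S. fact (count K y))"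
    by (subst prod.remove[of ?S x]) auto
  also have "\<dots> = (\<Prod>y\<in>set_mset K. fact (count K y))"
    by (rule prod.mono_neutral_right) (auto simp: not_in_iff)
  finally have "(\<Prod>y\<in>?S. fact (count (add_mset x K) y)) = Suc (count K x) * (\<Prod>y\<in>set_mset K. fact (count K y))" .
  thus ?thesis by (simp add: shape_norm_def algebra_simps)
qed

lemma zee_eq: "zee l = prod_list l * (\<Prod>i\<in>set l. fact (count (mset l) i))"
  by (simp add: zee_def prod.distrib count_mset prod_mset_prod_list[symmetric] prod_mset_multiplicity)

lemma power_int_sum: "(a :: 'a::field) \<noteq> 0 \<Longrightarrow> a powi (\<Sum>i\<in>A. f i) = (\<Prod>i\<in>A. a powi f i)"
  by (induction A rule: infinite_finite_induct) (auto simp: power_int_add)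

lemma power_sum_norm_eq:
  assumes "n \<ge> 1"
  shows "power_sum_norm n L = shape_norm n (shape n L)"
proof -
  let ?e = "\<lambda>k. (int n - 1 - int k) * int (sum_list (L ! k))"
  let ?c = "\<lambda>k. if k = n - 1 then \<Prod>r\<leftarrow>L ! k. (1 - qq ^ r) / (1 - tt ^ r) else 1"
  have list: "(\<Prod>r\<leftarrow>l. generator_norm n (k, r)) = of_nat (prod_list l) * qq powi ((int n - 1 - int k) * int (sum_list l))
      * (if k = n - 1 then \<Prod>r\<leftarrow>l. (1 - qq ^ r) / (1 - tt ^ r) else 1)" for k l
    by (induction l) (simp_all add: generator_norm_def power_int_add distrib_left)
  have "(\<Prod>x\<in>#shape n L. generator_norm n x) = (\<Prod>k<n. \<Prod>r\<leftarrow>L ! k. generator_norm n (k, r))"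
  proof -
    have "(\<Prod>x\<in>#(\<Sum>k<m. image_mset (Pair k) (mset (L ! k))). generator_norm n x) =
        (\<Prod>k<m. \<Prod>r\<leftarrow>L ! k. generator_norm n (k, r))" for m
      by (induction m) (simp_all add: image_mset.compositionality comp_def prod_mset_prod_list[symmetric])
    thus ?thesis by (simp add: shape_def)
  qed
  also have "\<dots> = (\<Prod>k<n. of_nat (prod_list (L ! k))) * qq powi (\<Sum>k<n. ?e k) * (\<Prod>k<n. ?c k)"
    by (simp add: list prod.distrib power_int_sum)
  also have "(\<Sum>k<n. ?e k) = (int n - 1) * int (bar_size n L) - int (bar_n n L)"
    by (simp add: bar_size_def bar_n_def sum_distrib_left left_diff_distrib sum_subtractf)
  also have "(\<Prod>k<n. ?c k) = (\<Prod>r\<leftarrow>L ! (n - 1). (1 - qq ^ r) / (1 - tt ^ r))"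
    using assms by (subst prod.delta) auto
  finally have 1: "(\<Prod>x\<in>#shape n L. generator_norm n x) = (\<Prod>k<n. of_nat (prod_list (L ! k)))
      * qq powi ((int n - 1) * int (bar_size n L) - int (bar_n n L))
      * (\<Prod>r\<leftarrow>L ! (n - 1). (1 - qq ^ r) / (1 - tt ^ r))" .
  have "(\<Prod>x\<in>set_mset (shape n L). fact (count (shape n L) x)) =
      (\<Prod>k<n. \<Prod>r\<in>set (L ! k). fact (count (shape n L) (k, r)) :: nat)"
    by (simp add: set_mset_shape prod.Sigma)
  also have "\<dots> = (\<Prod>k<n. \<Prod>r\<in>set (L ! k). fact (count (mset (L ! k)) r))"
    by (intro prod.cong refl) (simp add: count_shape)
  finally have 2: "(\<Prod>x\<in>set_mset (shape n L). fact (count (shape n L) x)) =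
      (\<Prod>k<n. \<Prod>r\<in>set (L ! k). fact (count (mset (L ! k)) r) :: nat)" .
  show ?thesis
    unfolding power_sum_norm_def shape_norm_def 1 2 zee_eq by (simp add: prod.distrib mult_ac)
qed

section \<open>Bilinearity, orthogonality and nondegeneracy of the scalar product\<close>

lemma multi_sym_space_span: "multi_sym_space n = mfps.span (multi_power_sum n ` multi_partitions n)"
  by (simp add: multi_sym_space_power power_monomial_image)

lemma power_sum_coeff_add:
  assumes "f \<in> multi_sym_space n" "g \<in> multi_sym_space n"
  shows "power_sum_coeff n (f + g) L = power_sum_coeff n f L + power_sum_coeff n g L"
  using assms unfolding power_sum_coeff_def multi_sym_space_span
  by (simp add: mfps.representation_add[OF independent_multi_power_sum])

lemma power_sum_coeff_scale:
  assumes "f \<in> multi_sym_space n"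
  shows "power_sum_coeff n (mfps_scale c f) L = c * power_sum_coeff n f L"
  using assms unfolding power_sum_coeff_def multi_sym_space_span
  by (simp add: mfps.representation_scale[OF independent_multi_power_sum])

lemma power_sum_coeff_basis:
  assumes "M \<in> multi_partitions n" "L \<in> multi_partitions n"
  shows "power_sum_coeff n (multi_power_sum n M) L = (if L = M then 1 else 0)"
  using assms inj_onD[OF inj_on_multi_power_sum, of n L M] unfolding power_sum_coeff_def
  by (subst mfps.representation_basis[OF independent_multi_power_sum]) auto

lemma finite_power_sum_coeff: "finite {L \<in> multi_partitions n. power_sum_coeff n f L \<noteq> 0}"
proof -
  have "finite (multi_power_sum n -` {b. mfps.representation (multi_power_sum n ` multi_partitions n) f b \<noteq> 0}
      \<inter> multi_partitions n)"
    by (rule finite_vimage_IntI[OF mfps.finite_representation inj_on_multi_power_sum])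
  thus ?thesis by (rule rev_finite_subset) (auto simp: power_sum_coeff_def)
qed

text \<open>The double sum collapses to its diagonal. The freedom in S lets several scalar products
  share one index set, so that bilinearity and symmetry can be checked term by term.\<close>

lemma scalar_product_sum:
  assumes "finite S" "S \<subseteq> multi_partitions n" "{L \<in> multi_partitions n. power_sum_coeff n f L \<noteq> 0} \<subseteq> S"
  shows "scalar_product n f g = (\<Sum>L\<in>S. power_sum_coeff n f L * power_sum_coeff n g L * power_sum_norm n L)"
proof -
  let ?F = "{L \<in> multi_partitions n. power_sum_coeff n f L \<noteq> 0}"
  let ?G = "{M \<in> multi_partitions n. power_sum_coeff n g M \<noteq> 0}"
  have "(\<Sum>M\<in>?G. power_sum_coeff n f L * power_sum_coeff n g M * (if L = M then power_sum_norm n L else 0))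
      = power_sum_coeff n f L * power_sum_coeff n g L * power_sum_norm n L" if "L \<in> ?F" for L
  proof -
    have "(\<Sum>M\<in>?G. power_sum_coeff n f L * power_sum_coeff n g M * (if L = M then power_sum_norm n L else 0))
      = (\<Sum>M\<in>?G. if L = M then power_sum_coeff n f L * power_sum_coeff n g M * power_sum_norm n M else 0)"
      by (intro sum.cong) auto
    also have "\<dots> = (if L \<in> ?G then power_sum_coeff n f L * power_sum_coeff n g L * power_sum_norm n L else 0)"
      by (rule sum.delta'[OF finite_power_sum_coeff])
    finally show ?thesis using that by auto
  qed
  hence "scalar_product n f g = (\<Sum>L\<in>?F. power_sum_coeff n f L * power_sum_coeff n g L * power_sum_norm n L)"
    unfolding scalar_product_def by (intro sum.cong refl)
  also have "\<dots> = (\<Sum>L\<in>S. power_sum_coeff n f L * power_sum_coeff n g L * power_sum_norm n L)"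
    using assms by (intro sum.mono_neutral_left) auto
  finally show ?thesis .
qed

lemma scalar_product_commute: "scalar_product n f g = scalar_product n g f"
proof -
  let ?S = "{L \<in> multi_partitions n. power_sum_coeff n f L \<noteq> 0} \<union> {L \<in> multi_partitions n. power_sum_coeff n g L \<noteq> 0}"
  have S: "finite ?S" "?S \<subseteq> multi_partitions n" using finite_power_sum_coeff by auto
  show ?thesis
    by (subst (1 2) scalar_product_sum[OF S]) (auto simp: mult_ac)
qed

lemma scalar_product_add_left:
  assumes "f \<in> multi_sym_space n" "f' \<in> multi_sym_space n"
  shows "scalar_product n (f + f') g = scalar_product n f g + scalar_product n f' g"
proof -
  let ?S = "{L \<in> multi_partitions n. power_sum_coeff n f L \<noteq> 0} \<union> {L \<in> multi_partitions n. power_sum_coeff n f' L \<noteq> 0}"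
  have S: "finite ?S" "?S \<subseteq> multi_partitions n" using finite_power_sum_coeff by auto
  show ?thesis
    by (subst (1 2 3) scalar_product_sum[OF S])
       (auto simp: power_sum_coeff_add[OF assms] algebra_simps sum.distrib)
qed

lemma scalar_product_scale_left:
  assumes "f \<in> multi_sym_space n"
  shows "scalar_product n (mfps_scale c f) g = c * scalar_product n f g"
proof -
  let ?S = "{L \<in> multi_partitions n. power_sum_coeff n f L \<noteq> 0}"
  have S: "finite ?S" "?S \<subseteq> multi_partitions n" using finite_power_sum_coeff by auto
  show ?thesis
    by (subst (1 2) scalar_product_sum[OF S])
       (auto simp: power_sum_coeff_scale[OF assms] sum_distrib_left mult_ac)
qed

lemma scalar_product_zero_left [simp]: "scalar_product n 0 g = 0"
  using scalar_product_scale_left[OF multi_sym_space_zero, of n 0 g] by simp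

lemma scalar_product_diff_left:
  assumes "f \<in> multi_sym_space n" "f' \<in> multi_sym_space n"
  shows "scalar_product n (f - f') g = scalar_product n f g - scalar_product n f' g"
  using scalar_product_add_left[OF multi_sym_space_diff[OF assms] assms(2), of g] by simp

lemma scalar_product_add_right:
  "g \<in> multi_sym_space n \<Longrightarrow> g' \<in> multi_sym_space n \<Longrightarrow>
    scalar_product n f (g + g') = scalar_product n f g + scalar_product n f g'"
  by (simp only: scalar_product_commute[of n f] scalar_product_add_left)

lemma scalar_product_diff_right:
  "g \<in> multi_sym_space n \<Longrightarrow> g' \<in> multi_sym_space n \<Longrightarrow>
    scalar_product n f (g - g') = scalar_product n f g - scalar_product n f g'"
  by (simp only: scalar_product_commute[of n f] scalar_product_diff_left)

lemma scalar_product_scale_right: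
  "g \<in> multi_sym_space n \<Longrightarrow> scalar_product n f (mfps_scale c g) = c * scalar_product n f g"
  by (simp only: scalar_product_commute[of n f] scalar_product_scale_left)

lemma scalar_product_zero_right [simp]: "scalar_product n f 0 = 0"
  by (simp add: scalar_product_commute[of n f])

lemma inj_on_power_monomial: "inj_on power_monomial (power_shapes n)"
proof (rule inj_onI)
  fix K K' assume "K \<in> power_shapes n" "K' \<in> power_shapes n" "power_monomial K = power_monomial K'"
  thus "K = K'"
    using inj_onD[OF inj_on_multi_power_sum, of n] by (auto simp: shape_image[symmetric] multi_power_sum_eq)
qed

lemma scalar_product_power_monomial:
  assumes "n \<ge> 1" "K \<in> power_shapes n" "K' \<in> power_shapes n"
  shows "scalar_product n (power_monomial K) (power_monomial K') = (if K = K' then shape_norm n K else 0)"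
proof -
  obtain L M where LM: "L \<in> multi_partitions n" "shape n L = K" "M \<in> multi_partitions n" "shape n M = K'"
    using shape_surj assms by metis
  have K: "K = K' \<longleftrightarrow> L = M" using LM inj_onD[OF inj_on_shape, of n L M] by auto
  have "scalar_product n (multi_power_sum n L) (multi_power_sum n M) =
     (\<Sum>N\<in>{L}. power_sum_coeff n (multi_power_sum n L) N * power_sum_coeff n (multi_power_sum n M) N * power_sum_norm n N)"
    using LM by (intro scalar_product_sum) (auto simp: power_sum_coeff_basis split: if_splits)
  also have "\<dots> = (if L = M then power_sum_norm n L else 0)"
    using LM by (simp add: power_sum_coeff_basis)
  finally show ?thesis
    using LM K by (auto simp: multi_power_sum_eq power_sum_norm_eq[OF assms(1)])
qed

text \<open>Pairing with a single power sum returns the coordinate of f times a nonzero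
  norm.\<close>

lemma scalar_product_nondegenerate:
  assumes n: "n \<ge> 1" and f: "f \<in> multi_sym_space n"
    and zero: "\<And>g. g \<in> multi_sym_space n \<Longrightarrow> scalar_product n f g = 0"
  shows "f = 0"
proof -
  have "power_sum_coeff n f L = 0" if L: "L \<in> multi_partitions n" for L
  proof -
    have "scalar_product n (multi_power_sum n L) f =
      (\<Sum>N\<in>{L}. power_sum_coeff n (multi_power_sum n L) N * power_sum_coeff n f N * power_sum_norm n N)"
      using L by (intro scalar_product_sum) (auto simp: power_sum_coeff_basis split: if_splits)
    hence "power_sum_coeff n f L * power_sum_norm n L = 0"
      using L zero[of "multi_power_sum n L"]
      by (simp add: power_sum_coeff_basis multi_sym_space_span mfps.span_base scalar_product_commute[of n f])
    thus ?thesis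
      using shape_norm_nonzero[OF shape_in_power_shapes[OF L]] by (simp add: power_sum_norm_eq[OF n])
  qed
  hence "mfps.representation (multi_power_sum n ` multi_partitions n) f b = 0" for b
    unfolding power_sum_coeff_def using mfps.representation_ne_zero by blast
  thus ?thesis
    using mfps.sum_nonzero_representation_eq[OF independent_multi_power_sum f[unfolded multi_sym_space_span]]
    by simp
qed

section \<open>Adjoints of multiplication operators\<close>

interpretation mfps_pair: vector_space_pair
  "mfps_scale :: qt \<Rightarrow> msf \<Rightarrow> msf" "mfps_scale :: qt \<Rightarrow> msf \<Rightarrow> msf" ..

text \<open>On polynomials in the generators this is the norm of x times the partial derivative with
  respect to x. The extension by \<open>construct\<close> is linear on all series, whereas the
  product rule holds on the multi-symmetric functions.\<close>

definition power_derivation :: "nat \<Rightarrow> nat \<times> nat \<Rightarrow> msf \<Rightarrow> msf" where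
  "power_derivation n x = mfps_pair.construct (power_monomial ` power_shapes n)
     (\<lambda>b. let K = inv_into (power_shapes n) power_monomial b
          in mfps_scale (generator_norm n x * of_nat (count K x)) (power_monomial (K - {#x#})))"

lemma independent_power_monomial: "mfps.independent (power_monomial ` power_shapes n)"
  by (simp add: power_monomial_image independent_multi_power_sum)

lemma power_derivation_add: "power_derivation n x (f + g) = power_derivation n x f + power_derivation n x g"
  and power_derivation_scale: "power_derivation n x (mfps_scale c f) = mfps_scale c (power_derivation n x f)"
proof -
  have "module_hom mfps_scale mfps_scale (power_derivation n x)"
    unfolding power_derivation_def module_hom_iff_linear
    by (rule mfps_pair.linear_construct[OF independent_power_monomial])
  thus "power_derivation n x (f + g) = power_derivation n x f + power_derivation n x g"
    and "power_derivation n x (mfps_scale c f) = mfps_scale c (power_derivation n x f)"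
    by (rule module_hom.add, rule module_hom.scale)
qed

lemma power_derivation_zero: "power_derivation n x 0 = 0"
  using power_derivation_scale[of n x 0 0] by simp

lemma power_derivation_monomial:
  assumes "K \<in> power_shapes n"
  shows "power_derivation n x (power_monomial K) =
    mfps_scale (generator_norm n x * of_nat (count K x)) (power_monomial (K - {#x#}))"
  unfolding power_derivation_def
  using assms by (subst mfps_pair.construct_basis[OF independent_power_monomial])
    (simp_all add: inv_into_f_f[OF inj_on_power_monomial])

lemma diff_power_shapes: "K \<in> power_shapes n \<Longrightarrow> K - {#x#} \<in> power_shapes n"
  by (auto simp: power_shapes_def dest: in_diffD)

lemma power_derivation_in_space: "f \<in> multi_sym_space n \<Longrightarrow> power_derivation n x f \<in> multi_sym_space n"
proof (induction rule: multi_sym_space_power_induct)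
  case zero
  show ?case by (simp add: power_derivation_zero multi_sym_space_zero)
next
  case (step c K f)
  thus ?case
    unfolding power_derivation_add power_derivation_scale power_derivation_monomial[OF step(1)]
    by (intro multi_sym_space_add multi_sym_space_scale power_monomial_in_space diff_power_shapes)
qed

lemma power_derivation_mult:
  assumes "y \<in> generators n" "f \<in> multi_sym_space n"
  shows "power_derivation n x (generator y * f) =
    mfps_scale (if x = y then generator_norm n x else 0) f + generator y * power_derivation n x f"
  using assms(2)
proof (induction rule: multi_sym_space_power_induct)
  case zero
  show ?case by (simp add: power_derivation_zero)
next
  case (step c K f)
  let ?N = "generator_norm n x" and ?k = "of_nat (count K x) :: qt"
  have K: "add_mset y K \<in> power_shapes n" using step(1) assms(1) by simp
  have "power_derivation n x (generator y * power_monomial K) =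
      mfps_scale (if x = y then ?N else 0) (power_monomial K) + generator y * power_derivation n x (power_monomial K)"
  proof (cases "x = y")
    case True
    \<comment> \<open>If x does not occur in K, its removal changes nothing, but then the scalar is
      0 on both sides.\<close>
    have cancel: "mfps_scale (?N * ?k) (generator y * power_monomial (K - {#x#})) = mfps_scale (?N * ?k) (power_monomial K)"
    proof (cases "x \<in># K")
      case x: True
      hence "generator y * power_monomial (K - {#x#}) = power_monomial K"
        unfolding power_monomial_add_mset[symmetric] True by simp
      thus ?thesis by simp
    next
      case False
      thus ?thesis by (simp add: not_in_iff)
    qed
    have "power_derivation n x (generator y * power_monomial K) = mfps_scale (?N * (1 + ?k)) (power_monomial K)"
      using power_derivation_monomial[OF K, of x] True by simp
    also have "\<dots> = mfps_scale ?N (power_monomial K) + mfps_scale (?N * ?k) (power_monomial K)"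
      by (simp only: distrib_left mult_1_right mfps.scale_left_distrib)
    also have "mfps_scale (?N * ?k) (power_monomial K) = generator y * power_derivation n x (power_monomial K)"
      by (simp only: power_derivation_monomial[OF step(1)] mfps_scale_mult_right cancel)
    finally show ?thesis by (simp only: if_P[OF True])
  next
    case False
    have "mfps_scale (?N * ?k) (power_monomial (add_mset y K - {#x#})) =
        mfps_scale (?N * ?k) (generator y * power_monomial (K - {#x#}))"
    proof (cases "x \<in># K")
      case True
      thus ?thesis using False by simp
    next
      case False
      thus ?thesis by (simp add: not_in_iff)
    qed
    thus ?thesis
      using power_derivation_monomial[OF K, of x] power_derivation_monomial[OF step(1), of x] False
      by simp
  qed
  thus ?case
    unfolding distrib_left power_derivation_add mfps.scale_right_distrib mfps_scale_mult_right
      power_derivation_scale step(3)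
    by (simp add: mfps.scale_right_distrib mult.commute)
qed

text \<open>By bilinearity it suffices to pair basis elements. Both sides vanish unless K arises
  from M by adding x, and in that case they agree by the recursion for the norm.\<close>

lemma power_derivation_adjoint:
  assumes n: "n \<ge> 1" and x: "x \<in> generators n" and f: "f \<in> multi_sym_space n" and g: "g \<in> multi_sym_space n"
  shows "scalar_product n f (generator x * g) = scalar_product n (power_derivation n x f) g"
  using f
proof (induction rule: multi_sym_space_power_induct)
  case zero
  show ?case by (simp add: power_derivation_zero)
next
  case (step c K f)
  have "scalar_product n (power_monomial K) (generator x * g) =
      scalar_product n (power_derivation n x (power_monomial K)) g"
    using g
  proof (induction rule: multi_sym_space_power_induct)
    case zero
    show ?case by simp
  next
    case (step d M g)
    have "scalar_product n (power_monomial K) (power_monomial (add_mset x M)) =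
        scalar_product n (power_derivation n x (power_monomial K)) (power_monomial M)"
    proof -
      have "K = add_mset x M \<longleftrightarrow> x \<in># K \<and> K - {#x#} = M" by auto
      moreover have "shape_norm n K = generator_norm n x * of_nat (count K x) * shape_norm n (K - {#x#})"
        if "x \<in># K"
        using shape_norm_add_mset[of n x "K - {#x#}"] that by simp
      ultimately show ?thesis
        using \<open>K \<in> power_shapes n\<close> step(1) x n
        by (auto simp: power_derivation_monomial scalar_product_power_monomial scalar_product_scale_left
            diff_power_shapes power_monomial_in_space not_in_iff simp del: power_monomial_add_mset)
    qed
    thus ?case
      using step x
      by (simp add: distrib_left scalar_product_add_right scalar_product_scale_right
          generator_mult_in_space power_monomial_in_space multi_sym_space_scale)
  qed
  thus ?case
    using step x
    by (simp add: power_derivation_add power_derivation_scale scalar_product_add_left scalar_product_scale_left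
        power_derivation_in_space power_monomial_in_space multi_sym_space_scale)
qed

text \<open>
  \<open>D\<close> is the adjoint of multiplication by the primitive element \<open>v\<close>; such an adjoint is a
  derivation, and \<open>e i s\<close> is its value on the power sum of degree \<open>s\<close> in the alphabet \<open>i\<close>.
\<close>

definition adjoint_derivation :: "nat \<Rightarrow> msf \<Rightarrow> (msf \<Rightarrow> msf) \<Rightarrow> (nat \<Rightarrow> nat \<Rightarrow> qt) \<Rightarrow> bool" where
  "adjoint_derivation n v D e \<longleftrightarrow>
     (\<forall>f g. D (f + g) = D f + D g) \<and> (\<forall>c f. D (mfps_scale c f) = mfps_scale c (D f)) \<and> D 1 = 0 \<and>
     (\<forall>f\<in>multi_sym_space n. D f \<in> multi_sym_space n \<and> v * f \<in> multi_sym_space n) \<and>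
     (\<forall>f\<in>multi_sym_space n. \<forall>g\<in>multi_sym_space n.
        scalar_product n f (v * g) = scalar_product n (D f) g) \<and>
     (\<forall>i<n. \<forall>s>0. \<forall>f\<in>multi_sym_space n.
        D (power_sum (alphabet i) s * f) = mfps_scale (e i s) f + power_sum (alphabet i) s * D f)"

text \<open>Since p_s(x^i) is generator (i, s) minus generator (i - 1, s), the derivative with
  respect to generator (k, r) sees it with sign plus for i = k and minus for i = k + 1.\<close>

definition generator_pairing :: "nat \<Rightarrow> nat \<Rightarrow> nat \<Rightarrow> nat \<Rightarrow> nat \<Rightarrow> qt" where
  "generator_pairing n k r i s = (if s = r \<and> i = k then generator_norm n (k, r) else 0)
     - (if s = r \<and> i = Suc k then generator_norm n (k, r) else 0)"

lemma adjoint_derivation_generator: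
  assumes "n \<ge> 1" "(k, r) \<in> generators n"
  shows "adjoint_derivation n (generator (k, r)) (power_derivation n (k, r)) (generator_pairing n k r)"
proof -
  have "power_derivation n (k, r) 1 = 0"
    using power_derivation_monomial[of "{#}" n "(k, r)"] by simp
  moreover have "power_derivation n (k, r) (power_sum (alphabet i) s * f) =
      mfps_scale (generator_pairing n k r i s) f + power_sum (alphabet i) s * power_derivation n (k, r) f"
    if "i < n" "s > 0" "f \<in> multi_sym_space n" for i s f
  proof -
    let ?D = "power_derivation n (k, r)" and ?N = "generator_norm n (k, r)"
    have diff: "?D (g - h) = ?D g - ?D h" for g h
      using power_derivation_add[of n "(k, r)" "g - h" h] by simp
    have 1: "?D (generator (i, s) * f) =
        mfps_scale (if s = r \<and> i = k then ?N else 0) f + generator (i, s) * ?D f"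
      using power_derivation_mult[of "(i, s)" n f "(k, r)"] that by (auto simp: generators_def)
    have 2: "?D ((if i = 0 then 0 else generator (i - 1, s)) * f) =
        mfps_scale (if s = r \<and> i = Suc k then ?N else 0) f + (if i = 0 then 0 else generator (i - 1, s)) * ?D f"
      using power_derivation_mult[of "(i - 1, s)" n f "(k, r)"] that
      by (cases i) (auto simp: generators_def power_derivation_zero)
    show ?thesis
      unfolding power_sum_alphabet_conv[OF that(2)] left_diff_distrib diff 1 2 generator_pairing_def
        mfps.scale_left_diff_distrib
      by (simp only: add_diff_add)
  qed
  ultimately show ?thesis
    using assms unfolding adjoint_derivation_def
    by (auto simp: power_derivation_add power_derivation_scale power_derivation_in_space
        generator_mult_in_space power_derivation_adjoint)
qed

text \<open>This provides the adjoint of multiplication by the power sum of a single alphabet, a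
  difference of two generators.\<close>

lemma adjoint_derivation_diff:
  assumes "adjoint_derivation n v D e" "adjoint_derivation n w E h"
  shows "adjoint_derivation n (v - w) (\<lambda>f. D f - E f) (\<lambda>i s. e i s - h i s)"
proof -
  note * = assms[unfolded adjoint_derivation_def]
  show ?thesis
    unfolding adjoint_derivation_def
    using * by (simp add: left_diff_distrib right_diff_distrib mfps.scale_right_diff_distrib
        mfps.scale_left_diff_distrib multi_sym_space_diff scalar_product_diff_left scalar_product_diff_right)
qed

section \<open>Inversion of the parameters\<close>

lemma qt_invert_zero [simp]: "qt_invert 0 = 0"
  using qt_invert_add[of 0 0] by simp

lemma qt_invert_one [simp]: "qt_invert 1 = 1"
proof -
  have "qt_invert 1 * qt_invert qq = qt_invert qq" by (simp flip: qt_invert_mult)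
  thus ?thesis by (simp add: qt_invert_qq)
qed

lemma qt_invert_minus: "qt_invert (- x) = - qt_invert x"
  using qt_invert_add[of x "- x"] by (simp add: eq_neg_iff_add_eq_0 add.commute)

lemma qt_invert_diff: "qt_invert (x - y) = qt_invert x - qt_invert y"
  using qt_invert_add[of x "- y"] by (simp add: qt_invert_minus)

lemma qt_invert_power: "qt_invert (x ^ k) = qt_invert x ^ k"
  by (induction k) (simp_all add: qt_invert_mult)

lemma qt_invert_of_nat [simp]: "qt_invert (of_nat k) = of_nat k"
  by (induction k) (simp_all add: qt_invert_add)

lemma qt_invert_inverse: "qt_invert (inverse x) = inverse (qt_invert x)"
proof (cases "x = 0")
  case False
  hence "qt_invert (inverse x) * qt_invert x = 1" by (simp flip: qt_invert_mult)
  thus ?thesis by (metis inverse_unique mult.commute)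
qed simp

lemma qt_invert_divide: "qt_invert (x / y) = qt_invert x / qt_invert y"
  by (simp add: divide_inverse qt_invert_mult qt_invert_inverse)

lemma qt_invert_sum: "qt_invert (sum f A) = (\<Sum>x\<in>A. qt_invert (f x))"
  by (induction A rule: infinite_finite_induct) (simp_all add: qt_invert_add)

text \<open>The map sigma of the overview. The rescaling follows the inversion of the coefficients,
  so its own powers of q stay uninverted.\<close>

definition invert_rescale :: "nat \<Rightarrow> msf \<Rightarrow> msf" where
  "invert_rescale n f = rescale_vars (\<lambda>(i, j). qq powi (int i + 1 - int n)) (map_mfps qt_invert f)"

lemma invert_rescale_add: "invert_rescale n (f + g) = invert_rescale n f + invert_rescale n g"
proof -
  have "map_mfps qt_invert (f + g) = map_mfps qt_invert f + map_mfps qt_invert g"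
    by (rule mfps_eqI) (simp add: map_mfps.rep_eq plus_mfps.rep_eq qt_invert_add)
  thus ?thesis by (simp add: invert_rescale_def rescale_vars_add)
qed

lemma invert_rescale_mult: "invert_rescale n (f * g) = invert_rescale n f * invert_rescale n g"
proof -
  have "map_mfps qt_invert (f * g) = map_mfps qt_invert f * map_mfps qt_invert g"
    by (rule mfps_eqI)
      (simp add: map_mfps.rep_eq times_mfps.rep_eq qt_invert_sum case_prod_unfold qt_invert_mult)
  thus ?thesis by (simp add: invert_rescale_def rescale_vars_mult)
qed

lemma invert_rescale_scale: "invert_rescale n (mfps_scale c f) = mfps_scale (qt_invert c) (invert_rescale n f)"
proof -
  have "map_mfps qt_invert (mfps_scale c f) = mfps_scale (qt_invert c) (map_mfps qt_invert f)"
    by (rule mfps_eqI) (simp add: map_mfps.rep_eq qt_invert_mult)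
  thus ?thesis by (simp add: invert_rescale_def rescale_vars_scale)
qed

lemma invert_rescale_one: "invert_rescale n 1 = 1"
proof -
  have "map_mfps qt_invert (1 :: msf) = 1"
    by (rule mfps_eqI) (simp add: map_mfps.rep_eq one_mfps.rep_eq)
  thus ?thesis by (simp add: invert_rescale_def rescale_vars_one)
qed

lemma invert_rescale_prod: "invert_rescale n (prod f A) = (\<Prod>x\<in>A. invert_rescale n (f x))"
  by (induction A rule: infinite_finite_induct) (simp_all add: invert_rescale_one invert_rescale_mult)

lemma invert_rescale_power_sum:
  assumes "r > 0"
  shows "invert_rescale n (power_sum (alphabet i) r) =
    mfps_scale (qq powi ((int i + 1 - int n) * int r)) (power_sum (alphabet i) r)"
proof -
  have "map_mfps qt_invert (power_sum (alphabet i) r :: msf) = power_sum (alphabet i) r"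
    by (rule mfps_eqI) (simp add: map_mfps.rep_eq mfps_nth_power_sum)
  moreover have "(qq powi (int i + 1 - int n)) ^ r = qq powi ((int i + 1 - int n) * int r)"
    by (simp add: power_int_mult)
  ultimately show ?thesis
    unfolding invert_rescale_def
    using rescale_vars_power_sum[OF assms, of "alphabet i" "\<lambda>(i, j). qq powi (int i + 1 - int n)" "qq powi (int i + 1 - int n)"]
    by (auto simp: alphabet_def)
qed

lemma invert_rescale_monomial_sym:
  "invert_rescale n (monomial_sym (alphabet i) l) =
    mfps_scale (qq powi ((int i + 1 - int n) * int (sum_list l))) (monomial_sym (alphabet i) l)"
proof (rule mfps_eqI)
  fix m :: "nat \<times> nat \<Rightarrow>\<^sub>0 nat"
  let ?a = "qq powi (int i + 1 - int n)" and ?c = "\<lambda>(i, j). qq powi (int i + 1 - int n) :: qt"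
  have "(\<Prod>v\<in>Poly_Mapping.keys m. ?c v ^ Poly_Mapping.lookup m v) = ?a ^ sum_list l"
    if "Poly_Mapping.keys m \<subseteq> alphabet i" "exponents m = mset l"
  proof -
    have "(\<Prod>v\<in>Poly_Mapping.keys m. ?c v ^ Poly_Mapping.lookup m v) =
        (\<Prod>v\<in>Poly_Mapping.keys m. ?a ^ Poly_Mapping.lookup m v)"
      using that(1) by (intro prod.cong) (auto simp: alphabet_def)
    also have "\<dots> = ?a ^ (\<Sum>v\<in>Poly_Mapping.keys m. Poly_Mapping.lookup m v)"
      by (rule power_sum[symmetric])
    also have "(\<Sum>v\<in>Poly_Mapping.keys m. Poly_Mapping.lookup m v) = sum_mset (exponents m)"
      by (simp add: exponents_def sum_unfold_sum_mset)
    finally show ?thesis by (simp add: that(2) sum_mset_sum_list)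
  qed
  thus "mfps_nth (invert_rescale n (monomial_sym (alphabet i) l)) m =
      mfps_nth (mfps_scale (qq powi ((int i + 1 - int n) * int (sum_list l))) (monomial_sym (alphabet i) l)) m"
    by (simp add: invert_rescale_def rescale_vars.rep_eq map_mfps.rep_eq mfps_nth_monomial_sym power_int_mult)
qed

lemma prod_mfps_scale:
  fixes c :: "'i \<Rightarrow> 'a::field"
  shows "(\<Prod>x\<in>A. mfps_scale (c x) (f x)) = mfps_scale (prod c A) (prod f A)"
  by (induction A rule: infinite_finite_induct) (simp_all add: mult_ac)

text \<open>The sum of (i+1-n) times the size of component i is the exponent of the theorem. As
  \<open>P L\<close> has leading term \<open>multi_monomial n L\<close>, no other eigenvalue is
  possible for it.\<close>

lemma invert_rescale_multi_monomial:
  "invert_rescale n (multi_monomial n L) =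
    mfps_scale (qq powi (int (bar_n n L) - (int n - 1) * int (bar_size n L))) (multi_monomial n L)"
proof -
  have "(\<Sum>i<n. (int i + 1 - int n) * int (sum_list (L ! i))) = int (bar_n n L) - (int n - 1) * int (bar_size n L)"
    by (simp add: bar_size_def bar_n_def sum_distrib_left algebra_simps sum.distrib sum_subtractf)
  thus ?thesis
    by (simp add: multi_monomial_def invert_rescale_prod invert_rescale_monomial_sym prod_mfps_scale
        flip: power_int_sum)
qed

text \<open>The two scalings of each variable are mutually inverse powers of q.\<close>

lemma plethysm_q_invert_rescale: "plethysm_q n (invert_rescale n f) = map_mfps qt_invert f"
proof (rule mfps_eqI)
  fix m :: "nat \<times> nat \<Rightarrow>\<^sub>0 nat"
  let ?c = "\<lambda>(i, j). qq powi (int i + 1 - int n) :: qt" and ?d = "\<lambda>(i, j). qq powi (int n - 1 - int i) :: qt"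
  have "?c v * ?d v = 1" for v :: "nat \<times> nat"
    by (cases v) (simp flip: power_int_add)
  hence "(\<Prod>v\<in>Poly_Mapping.keys m. ?c v ^ Poly_Mapping.lookup m v) *
      (\<Prod>v\<in>Poly_Mapping.keys m. ?d v ^ Poly_Mapping.lookup m v) = 1"
    by (simp only: prod.distrib[symmetric] power_mult_distrib[symmetric] power_one prod.neutral_const)
  thus "mfps_nth (plethysm_q n (invert_rescale n f)) m = mfps_nth (map_mfps qt_invert f) m"
    by (simp only: plethysm_q_def invert_rescale_def rescale_vars.rep_eq mult.assoc mult_1_right)
qed

lemma invert_rescale_in_space: "f \<in> multi_sym_space n \<Longrightarrow> invert_rescale n f \<in> multi_sym_space n"
proof (induction rule: multi_sym_space_induct)
  case one
  show ?case by (simp add: invert_rescale_one one_in_multi_sym_space)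
next
  case (mult i r f)
  thus ?case
    by (auto simp: invert_rescale_mult invert_rescale_power_sum
        intro!: multi_sym_space_scale power_sum_mult_multi_sym_space)
qed (auto simp: invert_rescale_add invert_rescale_scale intro: multi_sym_space_add multi_sym_space_scale)

section \<open>Pairings that are compatible with the inversion\<close>

lemma mfps_nth_power_monomial_0:
  assumes "K \<in> power_shapes n"
  shows "mfps_nth (power_monomial K) 0 = (if K = {#} then 1 else 0)"
proof (cases K)
  case empty
  thus ?thesis by (simp add: one_mfps.rep_eq)
next
  case (add x K')
  obtain k r where x: "x = (k, r)" by (cases x)
  have r: "r > 0" using assms by (simp add: add x generators_def)
  have "mfps_nth (generator x * power_monomial K') 0 = 0"
    unfolding x generator_def prod.case mfps_nth_power_sum_mult[OF r] using r by simp
  thus ?thesis by (simp add: add)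
qed

text \<open>Among the power monomials only the empty one pairs with 1, and only that one has a
  constant term. Sigma merely inverts constant terms, which makes 1 the starting point for
  compatibility.\<close>

lemma scalar_product_one:
  assumes "n \<ge> 1" "f \<in> multi_sym_space n"
  shows "scalar_product n f 1 = mfps_nth f 0"
  using assms(2)
proof (induction rule: multi_sym_space_power_induct)
  case zero
  show ?case by (simp add: zero_mfps.rep_eq)
next
  case (step c K f)
  have "scalar_product n (power_monomial K) 1 = mfps_nth (power_monomial K) 0"
    using scalar_product_power_monomial[OF assms(1) step(1), of "{#}"]
    by (simp add: mfps_nth_power_monomial_0[OF step(1)])
  thus ?case
    using step by (simp add: scalar_product_add_left scalar_product_scale_left plus_mfps.rep_eq
        power_monomial_in_space multi_sym_space_scale)
qed

text \<open>The final argument uses only that vanishing pairings keep vanishing. The factor c is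
  recorded because a difference of two such functions inherits the property when their factors
  agree.\<close>

definition inversion_compatible :: "nat \<Rightarrow> qt \<Rightarrow> msf \<Rightarrow> bool" where
  "inversion_compatible n c g \<longleftrightarrow> g \<in> multi_sym_space n \<and>
     (\<forall>f\<in>multi_sym_space n. scalar_product n (invert_rescale n f) g = c * qt_invert (scalar_product n f g))"

lemma inversion_compatible_one: "n \<ge> 1 \<Longrightarrow> inversion_compatible n 1 1"
  by (simp add: inversion_compatible_def one_in_multi_sym_space scalar_product_one invert_rescale_in_space)
     (simp add: invert_rescale_def rescale_vars.rep_eq map_mfps.rep_eq)

lemma inversion_compatible_diff:
  assumes "inversion_compatible n c f" "inversion_compatible n c g"
  shows "inversion_compatible n c (f - g)"
  using assms
  by (simp add: inversion_compatible_def multi_sym_space_diff scalar_product_diff_right qt_invert_diff right_diff_distrib)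

lemma inversion_compatible_scale:
  assumes "inversion_compatible n c f" "qt_invert a = a"
  shows "inversion_compatible n c (mfps_scale a f)"
  using assms
  by (simp add: inversion_compatible_def multi_sym_space_scale scalar_product_scale_right qt_invert_mult)

text \<open>Both sides are semilinear, vanish on 1 and obey product rules of the same form. They are
  therefore compared on the power sums of single alphabets, where the assumption on the constants
  \<open>e i s\<close> makes them equal.\<close>

lemma adjoint_derivation_invert_rescale:
  assumes D: "adjoint_derivation n v D e"
    and c: "\<And>i s. i < n \<Longrightarrow> s > 0 \<Longrightarrow> qq powi ((int i + 1 - int n) * int s) * e i s = c * qt_invert (e i s)"
    and f: "f \<in> multi_sym_space n"
  shows "D (invert_rescale n f) = mfps_scale c (invert_rescale n (D f))"
  using f
proof (induction rule: multi_sym_space_induct)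
  case one
  have "D 1 = 0" using D by (simp add: adjoint_derivation_def)
  moreover have "invert_rescale n 0 = 0" using invert_rescale_scale[of n 0 0] by simp
  ultimately show ?case by (simp add: invert_rescale_one)
next
  case (mult i s f)
  let ?p = "power_sum (alphabet i) s" and ?a = "qq powi ((int i + 1 - int n) * int s)"
  let ?\<sigma> = "invert_rescale n"
  note D' = D[unfolded adjoint_derivation_def]
  have deriv: "D (?p * g) = mfps_scale (e i s) g + ?p * D g" if "g \<in> multi_sym_space n" for g
    using D' mult(1,2) that by blast
  have scale: "D (mfps_scale b g) = mfps_scale b (D g)" for b g using D' by blast
  have "D (?\<sigma> (?p * f)) = mfps_scale ?a (mfps_scale (e i s) (?\<sigma> f) + ?p * mfps_scale c (?\<sigma> (D f)))"
    using mult by (simp only: invert_rescale_mult invert_rescale_power_sum mfps_scale_mult_left scale deriv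
        invert_rescale_in_space)
  also have "\<dots> = mfps_scale (?a * e i s) (?\<sigma> f) + mfps_scale (c * ?a) (?p * ?\<sigma> (D f))"
    by (simp add: mfps.scale_right_distrib mult.commute)
  also have "\<dots> = mfps_scale c (?\<sigma> (mfps_scale (e i s) f + ?p * D f))"
    using mult by (simp add: c invert_rescale_add invert_rescale_scale invert_rescale_mult
        invert_rescale_power_sum mfps.scale_right_distrib)
  finally show ?case using deriv[OF mult(3)] by simp
next
  case (add f g)
  have "D (a + b) = D a + D b" for a b using D by (simp add: adjoint_derivation_def)
  thus ?case using add by (simp add: invert_rescale_add mfps.scale_right_distrib)
next
  case (scale b f)
  have "D (mfps_scale a f) = mfps_scale a (D f)" for a f using D by (simp add: adjoint_derivation_def)
  thus ?case using scale by (simp add: invert_rescale_scale mult.commute)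
qed

text \<open>Move v to the other side as D, exchange D with sigma at the price of c, apply the
  compatibility of g, and move v back.\<close>

lemma inversion_compatible_mult:
  assumes D: "adjoint_derivation n v D e"
    and c: "\<And>i s. i < n \<Longrightarrow> s > 0 \<Longrightarrow> qq powi ((int i + 1 - int n) * int s) * e i s = c * qt_invert (e i s)"
    and g: "inversion_compatible n d g"
  shows "inversion_compatible n (c * d) (v * g)"
proof -
  note D' = D[unfolded adjoint_derivation_def]
  have g': "g \<in> multi_sym_space n"
    "\<And>f. f \<in> multi_sym_space n \<Longrightarrow> scalar_product n (invert_rescale n f) g = d * qt_invert (scalar_product n f g)"
    using g by (auto simp: inversion_compatible_def)
  have "scalar_product n (invert_rescale n f) (v * g) = c * d * qt_invert (scalar_product n f (v * g))"
    if f: "f \<in> multi_sym_space n" for f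
  proof -
    have Df: "D f \<in> multi_sym_space n" using D' f by blast
    have adj: "scalar_product n h (v * g) = scalar_product n (D h) g" if "h \<in> multi_sym_space n" for h
      using D' that g'(1) by blast
    have "scalar_product n (invert_rescale n f) (v * g) =
        scalar_product n (mfps_scale c (invert_rescale n (D f))) g"
      using adjoint_derivation_invert_rescale[OF D c f] adj[OF invert_rescale_in_space[OF f]] by simp
    also have "\<dots> = c * (d * qt_invert (scalar_product n (D f) g))"
      by (simp only: scalar_product_scale_left[OF invert_rescale_in_space[OF Df]] g'(2)[OF Df])
    finally show ?thesis by (simp only: adj[OF f] mult.assoc)
  qed
  moreover have "v * g \<in> multi_sym_space n" using D' g'(1) by blast
  ultimately show ?thesis by (simp add: inversion_compatible_def)
qed

lemma inversion_compatible_mult_total: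
  assumes n: "n \<ge> 1" and r: "r > 0" and g: "inversion_compatible n d g"
  shows "inversion_compatible n ((qq / tt) ^ r * d) (power_sum (alphabets n) r * g)"
proof -
  have "{..n - 1} = {..<n}" using n by auto
  hence "power_sum (alphabets n) r = generator (n - 1, r)"
    by (simp add: generator_def alphabets_def)
  moreover have "inversion_compatible n ((qq / tt) ^ r * d) (generator (n - 1, r) * g)"
  proof (rule inversion_compatible_mult[OF _ _ g])
    show "adjoint_derivation n (generator (n - 1, r)) (power_derivation n (n - 1, r)) (generator_pairing n (n - 1) r)"
      using n r by (intro adjoint_derivation_generator) (simp_all add: generators_def)
    fix i s :: nat assume i: "i < n" "s > 0"
    show "qq powi ((int i + 1 - int n) * int s) * generator_pairing n (n - 1) r i s =
        (qq / tt) ^ r * qt_invert (generator_pairing n (n - 1) r i s)"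
    \<comment> \<open>The union pairs only with the last alphabet, since i = n is out of range.
      There sigma does not rescale, and c is the ratio of (1 - q^r)/(1 - t^r) to its
      inversion.\<close>
    proof (cases "s = r \<and> i = n - 1")
      case True
      have "qq ^ r \<noteq> 0" "tt ^ r \<noteq> 0" "tt ^ r \<noteq> 1" using r tt_power_neq_1 by simp_all
      hence eq: "of_nat r * ((1 - qq ^ r) / (1 - tt ^ r)) = (qq / tt) ^ r * (of_nat r * ((1 - inverse (qq ^ r)) / (1 - inverse (tt ^ r))))"
        by (simp add: power_divide divide_simps) (simp add: algebra_simps)
      have E: "generator_pairing n (n - 1) r i s = of_nat r * ((1 - qq ^ r) / (1 - tt ^ r))"
        using True n by (simp add: generator_pairing_def generator_norm_def of_nat_diff)
      have inv: "qt_invert (of_nat r * ((1 - qq ^ r) / (1 - tt ^ r))) =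
          of_nat r * ((1 - inverse (qq ^ r)) / (1 - inverse (tt ^ r)))"
        by (simp only: qt_invert_mult qt_invert_of_nat qt_invert_divide qt_invert_diff qt_invert_one
            qt_invert_power qt_invert_qq qt_invert_tt power_inverse)
      have "int i + 1 - int n = 0" using True n by simp
      thus ?thesis unfolding E inv by (simp only: eq mult_zero_left power_int_0_right mult_1_left)
    next
      case False
      thus ?thesis using i by (auto simp: generator_pairing_def)
    qed
  qed
  ultimately show ?thesis by simp
qed

lemma inversion_compatible_mult_alphabet:
  assumes j: "1 \<le> j" "j < n" and r: "r > 0" and g: "inversion_compatible n d g"
  shows "inversion_compatible n ((qq ^ (n - j)) ^ r * d) (power_sum (alphabet j) r * g)"
proof -
  have "adjoint_derivation n (power_sum (alphabet j) r)
      (\<lambda>f. power_derivation n (j, r) f - power_derivation n (j - 1, r) f)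
      (\<lambda>i s. generator_pairing n j r i s - generator_pairing n (j - 1) r i s)"
    using adjoint_derivation_diff[OF adjoint_derivation_generator adjoint_derivation_generator, of n j r "j - 1" r] j r
    by (simp add: power_sum_alphabet_conv generators_def)
  thus ?thesis
  proof (rule inversion_compatible_mult[OF _ _ g])
    fix i s :: nat assume i: "i < n" "s > 0"
    define E where "E = generator_pairing n j r i s - generator_pairing n (j - 1) r i s"
    \<comment> \<open>In these terms the norms of the generators j and j - 1 are R A, with a further
      factor (1 - Q)/(1 - T) if j is last, and R A Q. The claimed factor c is A Q.\<close>
    define Q T A R :: qt where "Q = qq ^ r" and "T = tt ^ r" and "A = qq ^ ((n - 1 - j) * r)" and "R = of_nat r"
    have nz: "A \<noteq> 0" "Q \<noteq> 0" "T \<noteq> 0" "T \<noteq> 1"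
      using tt_power_neq_1[OF r] by (simp_all add: A_def Q_def T_def)
    have AQ: "qq ^ ((n - j) * r) = A * Q"
    proof -
      have "n - j = Suc (n - 1 - j)" using j by simp
      thus ?thesis by (simp add: A_def Q_def power_add mult.commute)
    qed
    have powi: "qq powi ((int a - int b) * int r) = qq ^ ((a - b) * r)" if "b \<le> a" for a b
      using that by (simp add: of_nat_diff[symmetric] of_nat_mult[symmetric] del: of_nat_mult of_nat_diff)
    have powi_inverse: "qq powi ((int a - int b) * int r) = inverse (qq ^ ((b - a) * r))" if "a \<le> b" for a b
    proof -
      have "(int a - int b) * int r = - ((int b - int a) * int r)" by (simp add: algebra_simps)
      thus ?thesis by (simp only: power_int_minus powi[OF that])
    qed
    have Nj: "generator_norm n (j, r) = R * A * (if j = n - 1 then (1 - Q) / (1 - T) else 1)"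
    proof -
      have "int n - 1 - int j = int (n - 1) - int j" using j by (simp add: of_nat_diff)
      thus ?thesis using powi[of j "n - 1"] j by (simp add: generator_norm_def A_def Q_def T_def R_def)
    qed
    have Nj1: "generator_norm n (j - 1, r) = R * (A * Q)"
    proof -
      have "int n - 1 - int (j - 1) = int n - int j" using j by (simp add: of_nat_diff)
      thus ?thesis using powi[of j n] j AQ by (auto simp: generator_norm_def R_def)
    qed
    have inv: "qt_invert A = inverse A" "qt_invert Q = inverse Q" "qt_invert T = inverse T" "qt_invert R = R"
      by (simp_all add: A_def Q_def T_def R_def qt_invert_power qt_invert_qq qt_invert_tt power_inverse)
    note invert = inv qt_invert_mult qt_invert_add qt_invert_diff qt_invert_minus qt_invert_divide
    \<comment> \<open>The two generators involved meet only the alphabets j - 1, j and j +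
      1.\<close>
    consider "s \<noteq> r" | "s = r" "i = j" | "s = r" "i = j - 1" | "s = r" "i = Suc j"
      | "s = r" "i \<noteq> j" "i \<noteq> j - 1" "i \<noteq> Suc j" by blast
    hence "qq powi ((int i + 1 - int n) * int s) * E = A * Q * qt_invert E"
    proof cases
      case 1
      thus ?thesis by (simp add: E_def generator_pairing_def)
    next
      case 2
      have "int i + 1 - int n = int (Suc j) - int n" using 2 by simp
      hence p: "qq powi ((int i + 1 - int n) * int s) = inverse A"
        using powi_inverse[of "Suc j" n] j by (simp only: 2) (simp add: A_def)
      have E: "E = generator_norm n (j, r) + generator_norm n (j - 1, r)"
        using 2 j by (simp add: E_def generator_pairing_def)
      show ?thesis
      proof (cases "j = n - 1")
        case True
        hence A: "A = 1" by (simp add: A_def)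
        have N: "generator_norm n (j, r) = R * ((1 - Q) / (1 - T))" by (simp only: Nj A if_P[OF True] mult_1_right)
        \<comment> \<open>The sum (1 - Q)/(1 - T) + Q equals (1 - Q T)/(1 - T), which the inversion
          divides by Q.\<close>
        have eq: "R * ((1 - Q) / (1 - T)) + R * Q =
            Q * (R * ((1 - inverse Q) / (1 - inverse T)) + R * inverse Q)"
          using nz by (simp add: divide_simps) (simp add: algebra_simps)
        show ?thesis
          unfolding p E N Nj1 A invert qt_invert_one inverse_1 mult_1_left by (rule eq)
      next
        case False
        hence N: "generator_norm n (j, r) = R * A" by (simp only: Nj if_False mult_1_right)
        \<comment> \<open>Inverting A + A Q divides it by A A Q; the rescaling contributes one
          inverse of A, and the factor A Q remains.\<close>
        have eq: "inverse A * (R * A + R * (A * Q)) = A * Q * (R * inverse A + R * (inverse A * inverse Q))"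
          using nz by (simp add: field_simps)
        show ?thesis unfolding p E N Nj1 invert by (rule eq)
      qed
    next
      case 3
      have "int i + 1 - int n = int j - int n" using 3 j by (simp add: of_nat_diff)
      hence p: "qq powi ((int i + 1 - int n) * int s) = inverse (A * Q)"
        using powi_inverse[of j n] j AQ by (simp only: 3(1))
      have E: "E = - generator_norm n (j - 1, r)"
        using 3 j by (auto simp: E_def generator_pairing_def)
      show ?thesis unfolding p E Nj1 invert using nz by simp
    next
      case 4
      \<comment> \<open>As alphabet j + 1 exists, j is not the last index, so its norm carries no
        factor in t.\<close>
      hence j': "Suc (Suc j) \<le> n" using i by simp
      have "int i + 1 - int n = int (Suc (Suc j)) - int n" using 4 by simp
      hence p: "qq powi ((int i + 1 - int n) * int s) = inverse (qq ^ ((n - Suc (Suc j)) * r))"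
        using powi_inverse[OF j'] by (simp only: 4(1))
      have "n - 1 - j = Suc (n - Suc (Suc j))" using j' by simp
      hence A: "A = qq ^ ((n - Suc (Suc j)) * r) * Q" by (simp add: A_def Q_def power_add mult.commute)
      have E: "E = - (R * A)"
      proof -
        have "j \<noteq> n - 1" "Suc j \<noteq> j - 1" "j \<noteq> j - 1" using j' j by auto
        thus ?thesis using 4 by (simp add: E_def generator_pairing_def Nj)
      qed
      show ?thesis using nz by (simp add: p E invert) (simp add: A)
    next
      case 5
      thus ?thesis using j by (simp add: E_def generator_pairing_def)
    qed
    thus "qq powi ((int i + 1 - int n) * int s) * (generator_pairing n j r i s - generator_pairing n (j - 1) r i s) =
        (qq ^ (n - j)) ^ r * qt_invert (generator_pairing n j r i s - generator_pairing n (j - 1) r i s)"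
      by (simp only: E_def AQ[symmetric] power_mult)
  qed
qed

section \<open>Merged monomial functions and dominance\<close>

text \<open>
  The image of \<open>multi_monomial n L\<close> under \<open>X\<^sup>(\<^sup>1\<^sup>) \<mapsto> X\<^sup>(\<^sup>1\<^sup>) + \<dots> + X\<^sup>(\<^sup>n\<^sup>)\<close>. For \<open>n > 1\<close>, \<open>multi_monomial n L\<close>
  itself is in general not compatible with the inversion.
\<close>

definition merged_monomial :: "nat \<Rightarrow> nat list list \<Rightarrow> msf" where
  "merged_monomial n L = monomial_sym (alphabets n) (L ! 0) * (\<Prod>i\<in>{1..<n}. monomial_sym (alphabet i) (L ! i))"

lemma inversion_compatible_merged_monomial:
  assumes n: "n \<ge> 1" and L: "L \<in> multi_partitions n"
  shows "\<exists>c. inversion_compatible n c (merged_monomial n L)"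
proof -
  have tail: "\<exists>c. inversion_compatible n c (\<Prod>i\<in>{1..<k}. monomial_sym (alphabet i) (L ! i))" if "k \<le> n" for k
    using that
  proof (induction k)
    case 0
    thus ?case using inversion_compatible_one[OF n] by auto
  next
    case (Suc k)
    then obtain c where c: "inversion_compatible n c (\<Prod>i\<in>{1..<k}. monomial_sym (alphabet i) (L ! i))" by auto
    show ?case
    proof (cases "k = 0")
      case True
      thus ?thesis using inversion_compatible_one[OF n] by auto
    next
      case False
      let ?h = "\<Prod>i\<in>{1..<k}. monomial_sym (alphabet i) (L ! i) :: msf"
      have "inversion_compatible n ((qq ^ (n - k)) ^ sum_list (L ! k) * c) (monomial_sym (alphabet k) (L ! k) * ?h)"
      \<comment> \<open>The factor depends on the degree alone, so all functions subtracted in the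
        induction carry the same one.\<close>
      proof (rule monomial_sym_induct[where \<Phi> = "\<lambda>d. inversion_compatible n ((qq ^ (n - k)) ^ d * c)"])
        show "inversion_compatible n ((qq ^ (n - k)) ^ 0 * c) ?h" using c by simp
        show "inversion_compatible n ((qq ^ (n - k)) ^ (d + r) * c) (power_sum (alphabet k) r * f)"
          if "r > 0" "inversion_compatible n ((qq ^ (n - k)) ^ d * c) f" for d r f
          using inversion_compatible_mult_alphabet[OF _ _ that, of k] False Suc.prems by (simp add: power_add mult_ac)
        show "0 \<notin> set (L ! k)" using zero_notin_partition[OF L] Suc.prems by simp
      qed (auto intro: inversion_compatible_diff inversion_compatible_scale simp: qt_invert_inverse)
      moreover have "{1..<Suc k} = insert k {1..<k}" using False by auto
      ultimately show ?thesis by auto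
    qed
  qed
  let ?h = "\<Prod>i\<in>{1..<n}. monomial_sym (alphabet i) (L ! i) :: msf"
  obtain c where c: "inversion_compatible n c ?h" using tail by blast
  have "inversion_compatible n ((qq / tt) ^ sum_list (L ! 0) * c) (monomial_sym (alphabets n) (L ! 0) * ?h)"
  proof (rule monomial_sym_induct[where \<Phi> = "\<lambda>d. inversion_compatible n ((qq / tt) ^ d * c)"])
    show "inversion_compatible n ((qq / tt) ^ 0 * c) ?h" using c by simp
    show "inversion_compatible n ((qq / tt) ^ (d + r) * c) (power_sum (alphabets n) r * f)"
      if "r > 0" "inversion_compatible n ((qq / tt) ^ d * c) f" for d r f
      using inversion_compatible_mult_total[OF n that] by (simp add: power_add mult_ac)
    show "0 \<notin> set (L ! 0)" using zero_notin_partition[OF L] n by simp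
  qed (auto intro: inversion_compatible_diff inversion_compatible_scale simp: qt_invert_inverse)
  thus ?thesis unfolding merged_monomial_def by blast
qed

section \<open>Bounds on sums of exponents, in the form of dominance inequalities\<close>

lemma sum_submultiset_le_take:
  assumes "sorted_wrt (\<ge>) l" "M \<subseteq># mset l" "size M \<le> j"
  shows "sum_mset M \<le> sum_list (take j (l :: nat list))"
  using assms
proof (induction l arbitrary: M j)
  case Nil
  thus ?case by simp
next
  case (Cons x l)
  show ?case
  proof (cases "M = {#}")
    case False
    \<comment> \<open>Remove x itself if it occurs in M and any element otherwise; either way the
      rest of M fits into the tail of the list.\<close>
    then obtain y where y: "y \<in># M" "x \<in># M \<longrightarrow> y = x" by (metis multiset_nonemptyE)
    obtain j' where j: "j = Suc j'"
      using Cons.prems(3) False by (cases j) auto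
    have "y \<in># mset (x # l)" using y(1) Cons.prems(2) by (rule mset_subset_eqD[rotated])
    hence "y \<le> x" using Cons.prems(1) by auto
    have "M - {#y#} \<subseteq># mset l"
    proof (cases "x \<in># M")
      case True
      thus ?thesis using y(2) Cons.prems(2) by (simp add: insert_subset_eq_iff subset_eq_diff_conv)
    next
      case False
      hence "M \<subseteq># mset l"
        using mset_subset_eq_count[OF Cons.prems(2)]
        by (intro mset_subset_eqI) (metis add_mset_remove_trivial count_add_mset le0 mset.simps(2) not_in_iff)
      thus ?thesis by (meson diff_subset_eq_self subset_mset.order_trans)
    qed
    moreover have "size (M - {#y#}) \<le> j'"
      using Cons.prems(3) y(1) j by (simp add: size_Diff_singleton)
    ultimately have "sum_mset (M - {#y#}) \<le> sum_list (take j' l)"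
      using Cons.IH Cons.prems(1) by simp
    moreover have "sum_mset M = y + sum_mset (M - {#y#})" using y(1) by (rule sum_mset.remove)
    ultimately show ?thesis using \<open>y \<le> x\<close> by (simp add: j)
  qed simp
qed

lemma sum_lookup_le_take:
  assumes l: "is_partition l" "exponents f = mset l" and S: "finite S" "card (S \<inter> Poly_Mapping.keys f) \<le> j"
  shows "(\<Sum>x\<in>S. Poly_Mapping.lookup f x) \<le> sum_list (take j l)"
proof -
  let ?M = "image_mset (Poly_Mapping.lookup f) (mset_set (S \<inter> Poly_Mapping.keys f))"
  have "(\<Sum>x\<in>S. Poly_Mapping.lookup f x) = (\<Sum>x\<in>S \<inter> Poly_Mapping.keys f. Poly_Mapping.lookup f x)"
    using S(1) by (intro sum.mono_neutral_right) (auto simp: in_keys_iff)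
  also have "\<dots> = sum_mset ?M" by (simp add: sum_unfold_sum_mset)
  also have "\<dots> \<le> sum_list (take j l)"
  proof (rule sum_submultiset_le_take)
    show "?M \<subseteq># mset l"
      unfolding l(2)[symmetric] exponents_def
      by (intro image_mset_subseteq_mono subset_imp_msubset_mset_set) auto
  qed (use l S in \<open>auto simp: is_partition_def\<close>)
  finally show ?thesis .
qed

lemma sum_lookup_le:
  assumes "is_partition l" "exponents f = mset l" "finite S"
  shows "(\<Sum>x\<in>S. Poly_Mapping.lookup f x) \<le> sum_list l"
proof -
  have "card (S \<inter> Poly_Mapping.keys f) \<le> length l"
    using card_mono[of "Poly_Mapping.keys f" "S \<inter> Poly_Mapping.keys f"]
      arg_cong[OF assms(2), of size] by (simp add: exponents_def)
  thus ?thesis using sum_lookup_le_take[OF assms, of "length l"] by simp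
qed

lemma sum_monomial_of_row:
  assumes "i < n"
  shows "(\<Sum>x\<in>{i} \<times> {..<min (length (L ! i)) j}. Poly_Mapping.lookup (monomial_of n L) x) = sum_list (take j (L ! i))"
proof -
  have "(\<Sum>x\<in>{i} \<times> {..<min (length (L ! i)) j}. Poly_Mapping.lookup (monomial_of n L) x) =
      (\<Sum>k<min (length (L ! i)) j. Poly_Mapping.lookup (monomial_of n L) (i, k))"
    by (simp add: sum.cartesian_product')
  also have "\<dots> = (\<Sum>k<min (length (L ! i)) j. L ! i ! k)"
    using assms by (intro sum.cong) (auto simp: monomial_of.rep_eq)
  finally show ?thesis
    by (simp add: sum_list_sum_nth atLeast0LessThan)
qed

text \<open>Dominance thus becomes a statement about exponents on a finite set of variables, which
  is additive over the factors of a monomial.\<close>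

lemma sum_monomial_of_dominance:
  assumes "k < n"
  shows "(\<Sum>x\<in>(SIGMA i:{..<k}. {..<length (L ! i)}) \<union> {k} \<times> {..<min (length (L ! k)) j}.
      Poly_Mapping.lookup (monomial_of n L) x)
    = (\<Sum>i<k. sum_list (L ! i)) + sum_list (take j (L ! k))"
proof -
  have "(\<Sum>x\<in>(SIGMA i:{..<k}. {..<length (L ! i)}). Poly_Mapping.lookup (monomial_of n L) x) =
      (\<Sum>i<k. \<Sum>x\<in>{i} \<times> {..<min (length (L ! i)) (length (L ! i))}. Poly_Mapping.lookup (monomial_of n L) x)"
  proof -
    have "(\<Sum>x\<in>(SIGMA i:{..<k}. {..<length (L ! i)}). Poly_Mapping.lookup (monomial_of n L) x) =
        (\<Sum>i<k. \<Sum>j<length (L ! i). Poly_Mapping.lookup (monomial_of n L) (i, j))"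
      by (simp add: sum.Sigma)
    thus ?thesis by (simp add: sum.cartesian_product')
  qed
  also have "\<dots> = (\<Sum>i<k. sum_list (L ! i))"
    using assms by (intro sum.cong refl) (subst sum_monomial_of_row, auto)
  finally show ?thesis
    by (subst sum.union_disjoint) (auto simp: sum_monomial_of_row[OF assms])
qed

lemma merged_monomial_in_space:
  assumes "n \<ge> 1" "L \<in> multi_partitions n"
  shows "merged_monomial n L \<in> multi_sym_space n"
  using inversion_compatible_merged_monomial[OF assms] by (auto simp: inversion_compatible_def)

lemma multi_monomial_in_space: "L \<in> multi_partitions n \<Longrightarrow> multi_monomial n L \<in> multi_sym_space n"
  by (simp add: multi_sym_space_def mfps.span_base)

text \<open>A monomial of the difference is a product of factors \<open>e i\<close> with exponents
  \<open>L ! i\<close>, where \<open>e i\<close> stays in alphabet i for i > 0, while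
  \<open>e 0\<close> reaches beyond alphabet 0. Moving weight from the first alphabet to later ones
  can only lower the sums that define dominance.\<close>

lemma merged_monomial_triangular:
  assumes n: "n \<ge> 1" and L: "L \<in> multi_partitions n"
  shows "merged_monomial n L - multi_monomial n L \<in>
    mfps.span (multi_monomial n ` {M \<in> multi_partitions n. strictly_dominated n M L})"
proof -
  \<comment> \<open>In the first factor all monomials contained in alphabet 0 cancel.\<close>
  define F where "F = (\<lambda>i. if i = 0 then monomial_sym (alphabets n) (L ! 0) - monomial_sym (alphabet 0) (L ! 0)
    else monomial_sym (alphabet i) (L ! i) :: msf)"
  have split: "{..<n} = insert 0 {1..<n}" using n by auto
  have prod: "(\<Prod>i\<in>{1..<n}. F i) = (\<Prod>i\<in>{1..<n}. monomial_sym (alphabet i) (L ! i))"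
    by (intro prod.cong) (auto simp: F_def)
  have diff: "merged_monomial n L - multi_monomial n L = (\<Prod>i<n. F i)"
    unfolding merged_monomial_def multi_monomial_def split
    by (simp add: prod left_diff_distrib) (simp add: F_def left_diff_distrib)
  have "strictly_dominated n M L"
    if M: "M \<in> multi_partitions n" and nz: "mfps_nth (\<Prod>i<n. F i) (monomial_of n M) \<noteq> 0" for M
  proof -
    obtain e where e: "monomial_of n M = sum e {..<n}" "\<And>i. i < n \<Longrightarrow> mfps_nth (F i) (e i) \<noteq> 0"
      using mfps_nth_prod_nonzero[OF finite_lessThan nz] by auto
    have lookup: "Poly_Mapping.lookup (monomial_of n M) x = (\<Sum>i<n. Poly_Mapping.lookup (e i) x)" for x
      by (simp add: e(1) lookup_sum)
    have sum: "(\<Sum>x\<in>S. Poly_Mapping.lookup (monomial_of n M) x) =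
        (\<Sum>i<n. \<Sum>x\<in>S. Poly_Mapping.lookup (e i) x)" for S
      by (simp add: lookup) (rule sum.swap)
    have exps: "exponents (e i) = mset (L ! i)" if "i < n" for i
      using e(2)[OF that] n
      by (auto simp: F_def mfps_nth_monomial_sym minus_mfps.rep_eq split: if_splits)
    have keys: "Poly_Mapping.keys (e i) \<subseteq> alphabet i" if "i < n" "i \<noteq> 0" for i
      using e(2)[OF that(1)] that(2) by (auto simp: F_def mfps_nth_monomial_sym split: if_splits)
    have keys0: "\<not> Poly_Mapping.keys (e 0) \<subseteq> alphabet 0"
    proof
      assume *: "Poly_Mapping.keys (e 0) \<subseteq> alphabet 0"
      moreover have "alphabet 0 \<subseteq> alphabets n" unfolding alphabets_def using n by (intro UN_upper) simp
      ultimately have "Poly_Mapping.keys (e 0) \<subseteq> alphabets n" by (rule subset_trans)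
      thus False
        using e(2)[of 0] n * by (auto simp: F_def mfps_nth_monomial_sym minus_mfps.rep_eq)
    qed
    have "dominated n M L"
      unfolding dominated_def
    proof (intro allI impI)
      fix k j assume k: "k < n"
      define S where "S = (SIGMA i:{..<k}. {..<length (M ! i)}) \<union> {k} \<times> {..<min (length (M ! k)) j}"
      have fin: "finite S" by (simp add: S_def)
      \<comment> \<open>Factors before k contribute at most their degree, factor k at most its j
        largest exponents, and later factors nothing, since S does not meet their alphabets.\<close>
      have bound: "(\<Sum>x\<in>S. Poly_Mapping.lookup (e i) x) \<le>
          (if i < k then sum_list (L ! i) else if i = k then sum_list (take j (L ! k)) else 0)" if i: "i < n" for i
      proof -
        note part = is_partition_nth[OF L i]
        consider "i < k" | "i = k" | "i > k" by linarith
        thus ?thesis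
        proof cases
          case 1
          thus ?thesis using sum_lookup_le[OF part exps[OF i] fin] by simp
        next
          case 2
          \<comment> \<open>For k = 0 the factor \<open>e 0\<close> is not confined to one alphabet,
            but S itself lies in alphabet 0.\<close>
          have "S \<inter> Poly_Mapping.keys (e i) \<subseteq> {k} \<times> {..<min (length (M ! k)) j}"
          proof (cases "k = 0")
            case True
            thus ?thesis by (auto simp: S_def)
          next
            case False
            thus ?thesis using keys[OF i] 2 by (auto simp: S_def alphabet_def)
          qed
          hence "card (S \<inter> Poly_Mapping.keys (e i)) \<le> card ({k} \<times> {..<min (length (M ! k)) j})"
            by (intro card_mono) auto
          also have "\<dots> \<le> j" by simp
          finally show ?thesis using sum_lookup_le_take[OF part exps[OF i] fin] 2 by simp
        next
          case 3
          hence "S \<inter> Poly_Mapping.keys (e i) = {}"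
            using keys[OF i] by (auto simp: S_def alphabet_def)
          thus ?thesis using sum_lookup_le_take[OF part exps[OF i] fin, of 0] 3 by simp
        qed
      qed
      have "(\<Sum>i<k. sum_list (M ! i)) + sum_list (take j (M ! k)) = (\<Sum>x\<in>S. Poly_Mapping.lookup (monomial_of n M) x)"
        unfolding S_def by (rule sum_monomial_of_dominance[OF k, symmetric])
      also have "\<dots> \<le> (\<Sum>i<n. if i < k then sum_list (L ! i) else if i = k then sum_list (take j (L ! k)) else 0)"
        unfolding sum using bound by (intro sum_mono) auto
      also have "\<dots> = (\<Sum>i<Suc k. if i < k then sum_list (L ! i) else if i = k then sum_list (take j (L ! k)) else 0)"
        using k by (intro sum.mono_neutral_right) auto
      also have "\<dots> = (\<Sum>i<k. sum_list (L ! i)) + sum_list (take j (L ! k))"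
        by simp
      finally show "(\<Sum>i<k. sum_list (M ! i)) + sum_list (take j (M ! k))
          \<le> (\<Sum>i<k. sum_list (L ! i)) + sum_list (take j (L ! k))" .
    qed
    moreover have "M \<noteq> L"
    proof
      assume "M = L"
      \<comment> \<open>Since v absorbs part of the degree of \<open>e 0\<close>, and the other
        factors avoid alphabet 0, the first component of M has size less than that of L.\<close>
      obtain v where v: "v \<in> Poly_Mapping.keys (e 0)" "v \<notin> alphabet 0" using keys0 by blast
      let ?l = "L ! 0"
      let ?S = "{0} \<times> {..<min (length ?l) (length ?l)}"
      have "sum_list ?l = (\<Sum>x\<in>?S. Poly_Mapping.lookup (monomial_of n M) x)"
        using sum_monomial_of_row[of 0 n L "length ?l"] n \<open>M = L\<close> by simp
      also have "\<dots> = (\<Sum>x\<in>?S. Poly_Mapping.lookup (e 0) x)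
          + (\<Sum>i\<in>{1..<n}. \<Sum>x\<in>?S. Poly_Mapping.lookup (e i) x)"
        unfolding sum split by simp
      also have "(\<Sum>i\<in>{1..<n}. \<Sum>x\<in>?S. Poly_Mapping.lookup (e i) x) = 0"
        using keys by (intro sum.neutral ballI) (fastforce simp: in_keys_iff alphabet_def)
      finally have "sum_list ?l = (\<Sum>x\<in>?S. Poly_Mapping.lookup (e 0) x)" by simp
      also have "\<dots> < (\<Sum>x\<in>insert v ?S. Poly_Mapping.lookup (e 0) x)"
        using v by (subst sum.insert) (auto simp: alphabet_def in_keys_iff)
      also have "\<dots> \<le> sum_list ?l"
        using n by (intro sum_lookup_le is_partition_nth[OF L] exps) auto
      finally show False by simp
    qed
    ultimately show ?thesis by (simp add: strictly_dominated_def)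
  qed
  moreover have "merged_monomial n L - multi_monomial n L \<in> multi_sym_space n"
    using assms by (intro multi_sym_space_diff merged_monomial_in_space multi_monomial_in_space)
  ultimately show ?thesis
    using multi_monomial_expansion[of "merged_monomial n L - multi_monomial n L" n]
      mfps.span_mono[OF image_mono, of
        "{M \<in> multi_partitions n. mfps_nth (\<Prod>i<n. F i) (monomial_of n M) \<noteq> 0}"
        "{M \<in> multi_partitions n. strictly_dominated n M L}" "multi_monomial n"]
    unfolding diff by blast
qed

section \<open>Dominance as a well-founded partial order\<close>

lemma dominated_refl: "dominated n L L"
  by (simp add: dominated_def)

lemma dominated_trans: "dominated n L M \<Longrightarrow> dominated n M N \<Longrightarrow> dominated n L N"
  by (fastforce simp: dominated_def intro: order_trans)

text \<open>As the entries are nonzero, the partial sums also reveal where a list ends.\<close>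

lemma list_eq_if_sum_list_take_eq:
  fixes l l' :: "nat list"
  assumes "0 \<notin> set l" "0 \<notin> set l'" "\<And>j. sum_list (take j l) = sum_list (take j l')"
  shows "l = l'"
  using assms
proof (induction l arbitrary: l')
  case Nil
  show ?case
  proof (cases l')
    case (Cons y ys)
    thus ?thesis using Nil(3)[of 1] Nil(2) by simp
  qed simp
next
  case (Cons x xs)
  show ?case
  proof (cases l')
    case Nil
    thus ?thesis using Cons.prems(3)[of 1] Cons.prems(1) by simp
  next
    case l': (Cons y ys)
    have "x = y" using Cons.prems(3)[of 1] l' by simp
    moreover have "sum_list (take j xs) = sum_list (take j ys)" for j
      using Cons.prems(3)[of "Suc j"] l' \<open>x = y\<close> by simp
    ultimately show ?thesis using Cons.IH[of ys] Cons.prems l' by auto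
  qed
qed

lemma dominated_antisym:
  assumes "L \<in> multi_partitions n" "M \<in> multi_partitions n" "dominated n L M" "dominated n M L"
  shows "L = M"
proof -
  have eq: "(\<Sum>i<k. sum_list (L ! i)) + sum_list (take j (L ! k)) =
      (\<Sum>i<k. sum_list (M ! i)) + sum_list (take j (M ! k))" if "k < n" for k j
    using assms(3,4) that by (auto simp: dominated_def intro: antisym)
  have rows: "(\<Sum>i<k. sum_list (L ! i)) = (\<Sum>i<k. sum_list (M ! i))" if "k < n" for k
    using eq[OF that, of 0] by simp
  have len: "length L = n" "length M = n" using assms by (auto simp: multi_partitions_def)
  show ?thesis
  proof (rule nth_equalityI)
    fix k assume "k < length L"
    hence k: "k < n" using len by simp
    show "L ! k = M ! k"
      using eq[OF k] rows[OF k] zero_notin_partition[OF assms(1) k] zero_notin_partition[OF assms(2) k]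
      by (intro list_eq_if_sum_list_take_eq) auto
  qed (simp add: len)
qed

lemma dominated_bar_size:
  assumes "n \<ge> 1" "dominated n M L"
  shows "bar_size n M \<le> bar_size n L"
proof -
  obtain k where k: "n = Suc k" using assms(1) by (cases n) auto
  have "k < n" by (simp add: k)
  \<comment> \<open>A value of j beyond both last components makes the truncated sums total.\<close>
  from assms(2)[unfolded dominated_def, rule_format, OF this, of "max (length (M ! k)) (length (L ! k))"]
  show ?thesis by (simp add: bar_size_def k)
qed

text \<open>Well-foundedness holds because dominance bounds the total size, so only finitely many
  multi-partitions lie below a given one.\<close>

lemma strictly_dominated_induct [consumes 2, case_names less]:
  assumes n: "n \<ge> 1" and L: "L \<in> multi_partitions n"
    and step: "\<And>L. L \<in> multi_partitions n \<Longrightarrow>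
      (\<And>M. M \<in> multi_partitions n \<Longrightarrow> strictly_dominated n M L \<Longrightarrow> P M) \<Longrightarrow> P L"
  shows "P L"
  using L
proof (induction "card {M \<in> multi_partitions n. dominated n M L}" arbitrary: L rule: less_induct)
  case less
  show ?case
  proof (rule step[OF less.prems])
    fix M assume M: "M \<in> multi_partitions n" "strictly_dominated n M L"
    have "{N \<in> multi_partitions n. dominated n N M} \<subset> {N \<in> multi_partitions n. dominated n N L}"
      using M less.prems dominated_trans[of n _ M L] dominated_antisym[of L n M] dominated_refl[of n L]
      unfolding strictly_dominated_def by blast
    moreover have "finite {N \<in> multi_partitions n. dominated n N L}"
      by (rule finite_subset[OF _ finite_bounded_multi_partitions[of n "bar_size n L"]])
        (use dominated_bar_size[OF n] in auto)
    ultimately show "P M" using M(1) by (intro less.hyps psubset_card_mono)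
  qed
qed

section \<open>From triangularity and orthogonality to the eigenvector equation\<close>

lemma scalar_product_span_zero:
  assumes "f \<in> mfps.span B" "\<And>b. b \<in> B \<Longrightarrow> b \<in> multi_sym_space n \<and> scalar_product n g b = 0"
  shows "scalar_product n g f = 0"
proof -
  from assms(1) have "f \<in> multi_sym_space n \<and> scalar_product n g f = 0"
  proof (induction rule: mfps.span_induct_alt)
    case base
    show ?case by (simp add: multi_sym_space_zero)
  next
    case (step c x y)
    thus ?case
      using assms(2)[of x]
      by (simp add: multi_sym_space_add multi_sym_space_scale scalar_product_add_right scalar_product_scale_right)
  qed
  thus ?thesis by simp
qed

text \<open>If M does not lie above L, neither does anything below M, so all lower terms of b pair
  to 0 with g. This exchanges monomial functions for \<open>P\<close> or for merged monomials, in
  either direction.\<close>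

lemma scalar_product_unitriangular:
  assumes n: "n \<ge> 1" and M: "M \<in> multi_partitions n" "\<not> dominated n L M"
    and b: "b - multi_monomial n M \<in> mfps.span (multi_monomial n ` {N \<in> multi_partitions n. strictly_dominated n N M})"
    and lower: "\<And>N. N \<in> multi_partitions n \<Longrightarrow> strictly_dominated n N M \<Longrightarrow> \<not> dominated n L N \<Longrightarrow>
      scalar_product n g (multi_monomial n N) = 0"
  shows "scalar_product n g b = scalar_product n g (multi_monomial n M)"
proof -
  have "scalar_product n g (b - multi_monomial n M) = 0"
  proof (rule scalar_product_span_zero[OF b])
    fix x assume "x \<in> multi_monomial n ` {N \<in> multi_partitions n. strictly_dominated n N M}"
    then obtain N where N: "N \<in> multi_partitions n" "strictly_dominated n N M" "x = multi_monomial n N" by auto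
    hence "\<not> dominated n L N" using M(2) dominated_trans[of n L N M] by (auto simp: strictly_dominated_def)
    thus "x \<in> multi_sym_space n \<and> scalar_product n g x = 0"
      using N lower multi_monomial_in_space by simp
  qed
  moreover have "b - multi_monomial n M \<in> multi_sym_space n"
    using b mfps.span_mono[OF image_mono, of "{N \<in> multi_partitions n. strictly_dominated n N M}" "multi_partitions n" "multi_monomial n"]
    unfolding multi_sym_space_def by auto
  ultimately show ?thesis
    using scalar_product_add_right[OF multi_monomial_in_space[OF M(1)], of "b - multi_monomial n M" g] by simp
qed

text \<open>Dominance is only partial, so orthogonality to \<open>multi_monomial n N\<close> is
  established for every N that does not lie above L, incomparable ones included.\<close>

lemma multi_macdonald_invert_rescale:
  assumes n: "n \<ge> 1" and P: "multi_macdonald n P" and L: "L \<in> multi_partitions n"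
  shows "invert_rescale n (P L) = mfps_scale (qq powi (int (bar_n n L) - (int n - 1) * int (bar_size n L))) (P L)"
proof -
  let ?mp = "multi_partitions n" and ?V = "multi_sym_space n" and ?m = "multi_monomial n"
  let ?\<sigma> = "invert_rescale n"
  define s where "s = (\<lambda>M. qq powi (int (bar_n n M) - (int n - 1) * int (bar_size n M)))"
  define U where "U = (\<lambda>M. ?m ` {N \<in> ?mp. strictly_dominated n N M})"
  have span: "mfps.span (P ` ?mp) = ?V" using P by (simp add: multi_macdonald_def is_basis_family_def)
  have tri: "P M - ?m M \<in> mfps.span (U M)" if "M \<in> ?mp" for M
    using P that by (simp add: multi_macdonald_def U_def)
  have orth: "scalar_product n (P M) (P N) = 0" if "M \<in> ?mp" "N \<in> ?mp" "M \<noteq> N" for M N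
    using P that by (simp add: multi_macdonald_def)
  have PV: "P M \<in> ?V" if "M \<in> ?mp" for M
    using that span mfps.span_base[of "P M" "P ` ?mp"] by auto
  have P_perp: "scalar_product n (P M) (?m N) = 0" if "M \<in> ?mp" "N \<in> ?mp" "\<not> dominated n M N" for M N
    using n that(2,3)
  proof (induction N rule: strictly_dominated_induct)
    case (less N)
    have "scalar_product n (P M) (P N) = scalar_product n (P M) (?m N)"
      using less tri[of N] by (intro scalar_product_unitriangular[OF n, where L = M]) (auto simp: U_def)
    moreover have "M \<noteq> N" using less.prems dominated_refl by auto
    ultimately show ?case using orth[OF that(1) less.hyps(1)] by simp
  qed
  have P_perp_merged: "scalar_product n (P L) (merged_monomial n N) = 0" if "N \<in> ?mp" "\<not> dominated n L N" for N
    using scalar_product_unitriangular[OF n that merged_monomial_triangular[OF n that(1)], of "P L"]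
      P_perp[OF L] that by simp
  have \<sigma>_perp_merged: "scalar_product n (?\<sigma> (P L)) (merged_monomial n N) = 0" if "N \<in> ?mp" "\<not> dominated n L N" for N
    using inversion_compatible_merged_monomial[OF n that(1)] P_perp_merged[OF that] PV[OF L]
    by (auto simp: inversion_compatible_def)
  \<comment> \<open>Merging is undone by induction along dominance, since a merged monomial differs
    from the plain one by lower terms.\<close>
  have \<sigma>_perp: "scalar_product n (?\<sigma> (P L)) (?m N) = 0" if "N \<in> ?mp" "\<not> dominated n L N" for N
    using n that
  proof (induction N rule: strictly_dominated_induct)
    case (less N)
    have "scalar_product n (?\<sigma> (P L)) (merged_monomial n N) = scalar_product n (?\<sigma> (P L)) (?m N)"
      using less merged_monomial_triangular[OF n less.hyps(1)]
      by (intro scalar_product_unitriangular[OF n, where L = L]) auto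
    thus ?case using \<sigma>_perp_merged[OF less.hyps(1) less.prems] by simp
  qed
  \<comment> \<open>Division by the eigenvalue restores the leading coefficient 1, so the leading
    terms cancel in d.\<close>
  define d where "d = mfps_scale (inverse (s L)) (?\<sigma> (P L)) - P L"
  have s: "s L \<noteq> 0" by (simp add: s_def)
  have \<sigma>V: "?\<sigma> (P L) \<in> ?V" using PV[OF L] by (rule invert_rescale_in_space)
  have dV: "d \<in> ?V" unfolding d_def using \<sigma>V PV[OF L] by (intro multi_sym_space_diff multi_sym_space_scale)
  have d_perp: "scalar_product n d (?m N) = 0" if "N \<in> ?mp" "\<not> dominated n L N" for N
    unfolding d_def
    using \<sigma>_perp[OF that] P_perp[OF L that] \<sigma>V PV[OF L]
    by (simp add: scalar_product_diff_left scalar_product_scale_left multi_sym_space_scale)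
  have d_lower: "d \<in> mfps.span (U L)"
  proof -
    have U: "?\<sigma> x \<in> mfps.span (U L)" if "x \<in> mfps.span (U L)" for x
      using that
    proof (induction rule: mfps.span_induct_alt)
      case base
      have "?\<sigma> 0 = 0" using invert_rescale_scale[of n 0 0] by simp
      thus ?case by (simp add: mfps.span_zero)
    next
      case (step c x y)
      then obtain N where "x = ?m N" "x \<in> U L" by (auto simp: U_def)
      hence "?\<sigma> x \<in> mfps.span (U L)"
        by (simp add: invert_rescale_multi_monomial mfps.span_scale mfps.span_base)
      thus ?case
        using step by (simp add: invert_rescale_add invert_rescale_scale mfps.span_add mfps.span_scale)
    qed
    have "?\<sigma> (P L) = ?\<sigma> (P L - ?m L) + mfps_scale (s L) (?m L)"
      using invert_rescale_add[of n "P L - ?m L" "?m L"] by (simp add: invert_rescale_multi_monomial s_def)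
    hence "d = mfps_scale (inverse (s L)) (?\<sigma> (P L - ?m L)) - (P L - ?m L)"
      unfolding d_def using s by (simp add: mfps.scale_right_distrib)
    thus ?thesis using U[OF tri[OF L]] tri[OF L] by (simp add: mfps.span_diff mfps.span_scale)
  qed
  have d_perp_P: "scalar_product n d (P N) = 0" if N: "N \<in> ?mp" for N
  \<comment> \<open>If N is not above L, expand \<open>P N\<close>: no term of it lies above L, so d
    is orthogonal to each. If N is above L, expand d: its terms lie strictly below L, hence not
    above N, so \<open>P N\<close> is orthogonal to each.\<close>
  proof (cases "dominated n L N")
    case False
    thus ?thesis
      using scalar_product_unitriangular[OF n N False, of "P N" d] tri[OF N] d_perp N by (simp add: U_def)
  next
    case True
    have "scalar_product n (P N) d = 0"
    proof (rule scalar_product_span_zero[OF d_lower])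
      fix x assume "x \<in> U L"
      then obtain M where M: "M \<in> ?mp" "strictly_dominated n M L" "x = ?m M" by (auto simp: U_def)
      have "\<not> dominated n N M"
        using M True L dominated_trans[of n L N M] dominated_antisym[of L n M]
        by (auto simp: strictly_dominated_def)
      thus "x \<in> ?V \<and> scalar_product n (P N) x = 0"
        using M N P_perp multi_monomial_in_space by simp
    qed
    thus ?thesis by (simp add: scalar_product_commute)
  qed
  have "scalar_product n d g = 0" if "g \<in> ?V" for g
    by (rule scalar_product_span_zero[of g "P ` ?mp"]) (use that PV span d_perp_P in auto)
  hence "d = 0" using scalar_product_nondegenerate[OF n dV] by blast
  hence "mfps_scale (s L) (mfps_scale (inverse (s L)) (?\<sigma> (P L))) = mfps_scale (s L) (P L)"
    by (simp add: d_def)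
  thus ?thesis using s by (simp add: s_def)
qed

theorem proposition5:
  fixes n :: nat and P :: "nat list list \<Rightarrow> msf" and L :: "nat list list"
  assumes "n \<ge> 1"
    and "multi_macdonald n P"
    and "L \<in> multi_partitions n"
  shows "map_mfps qt_invert (P L) =
    mfps_scale (qq powi (int (bar_n n L) - (int n - 1) * int (bar_size n L)))
      (plethysm_q n (P L))"
proof -
  \<comment> \<open>The plethysm is linear, so it carries the eigenvector equation of sigma directly
    to the claim.\<close>
  have "map_mfps qt_invert (P L) = plethysm_q n (invert_rescale n (P L))"
    by (rule plethysm_q_invert_rescale[symmetric])
  thus ?thesis
    by (simp only: multi_macdonald_invert_rescale[OF assms] plethysm_q_def rescale_vars_scale)
qed

end
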